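(* Let $f\in L^2([0,1)^d)$ and let data $Y^n=\delta^n f+\xi^n$, $n\in\mathbb M$, be given. Assume: (1) there are $\kappa>0$ and $M>0$ such that $|\mathscr R^n|\ge M n^\kappa$ for all sufficiently large $n\in\mathbb M$; (2) there is $\beta>0$ such that for each $n\in\mathbb M$, all real numbers $\mu_s$, $s\in S^n$, and each $c\ge 0$, $$\mathbb P\Big(\Big|\sum_{s\in S^n}\mu_s\xi_s^n\Big|\ge c\Big)\le 2\exp\Big(-\frac{c^2}{\beta\sum_{s\in S^n}\mu_s^2}\Big);$$ (3) $(\gamma_n)$ is a positive sequence with $\gamma_n\to 0$ and, for all sufficiently large $n$, $\gamma_n>\beta D\,\frac{\kappa+1}{\kappa}\cdot\frac{\ln|\mathscr R^n|}{|S^n|}$, where $D$ is an upper bound for the dimensions of the spaces $\mathscr G^n_P$, $P\in\mathscr R^n$, $n\in\mathbb M$; (4) $$\lim_{k\to\infty}\ \limsup_{n\to\infty,\,n\in\mathbb M}\ \inf_{(\mathscr Q,h)\in\mathfrak S^n,\ |\mathscr Q|\le k}\|\iota^n h-f\|^2=0 .$$ For each $n\in\mathbb M$ let $(\hat{\mathscr P}^n,\hat f^n)$ be a minimiser over $(\mathscr Q,h)\in\mathfrak S^n$ of $\gamma_n|\mathscr Q|+\|h-Y^n\|^2/|S^n|$. Then for almost all $\omega\in\Omega$, $$\|\iota^n\hat f^n(\omega)-f\|^2\longrightarrow 0\quad\text{as } n\to\infty,\ n\in\mathbb M .$$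
   Context: $\mathbb M$ is an infinite subset of $\mathbb N=\{1,2,\dots\}$; $d\in\mathbb N$; $S^n=\{1,\dots,n\}^d$. For $s=(i_1,\dots,i_d)\in S^n$ let $I_s=I^n_s=\prod_{j=1}^d[(i_j-1)/n,i_j/n)$. Define $\delta^n:L^2([0,1)^d)\to\mathbb R^{S^n}$ by $(\delta^n g)_s=n^d\int_{I_s}g(u)\,du$ and $\iota^n:\mathbb R^{S^n}\to L^2([0,1)^d)$ by $\iota^n z=\sum_{s\in S^n}z_s\mathbf 1_{I_s}$. The norm of elements of $\mathbb R^{S^n}$ is Euclidean; the norm of functions on $[0,1)^d$ is that of $L^2$. The noise variables $\xi^n=(\xi^n_s)_{s\in S^n}$, $n\in\mathbb M$, are real random variables on a common probability space $(\Omega,\mathscr F,\mathbb P)$. Projective segmentation classes: fix a finite-dimensional linear subspace $\mathscr G\subset L^2([0,1)^d)$. For $P\subset S^n$ let $\mathscr G^n_P=\{\mathbf 1_P\cdot \delta^n g: g\in\mathscr G\}\subset\mathbb R^{S^n}$. For each $n\in\mathbb M$ a set $\mathscr R^n\subset 2^{S^n}$ of admissible fragments and a (nonempty) set $\mathfrak P^n$ of partitions of $S^n$ all of whose elements belong to $\mathscr R^n$ are given. For $\mathscr P\in\mathfrak P^n$ let $\mathscr G_{\mathscr P}=\mathrm{span}\{\mathscr G^n_P:P\in\mathscr P\}$. Then $\mathfrak S^n=\{(\mathscr P,h):\mathscr P\in\mathfrak P^n,\ h\in\mathscr G_{\mathscr P}\}$; $|\mathscr P|$ is the number of elements of $\mathscr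 P$. *)

theory Defs
  imports "HOL-Probability.Probability" "HOL-Library.Function_Algebras"
begin

text \<open>The pointwise vector space structure on functions makes \<^term>\<open>span\<close>, \<^term>\<open>subspace\<close> and
  \<^term>\<open>dim\<close> available for arrays and for (representatives of) elements of $L^2$.\<close>

instantiation "fun" :: (type, real_vector) real_vector
begin

definition scaleR_fun :: "real \<Rightarrow> ('a \<Rightarrow> 'b) \<Rightarrow> 'a \<Rightarrow> 'b" where
  "scaleR_fun r f = (\<lambda>x. r *\<^sub>R f x)"

instance
  by standard (simp_all add: scaleR_fun_def fun_eq_iff scaleR_add_right scaleR_add_left)

end


text \<open>The dimension $d$ is the cardinality of the index type \<^typ>\<open>'d::finite\<close>.\<close>

definition unit_cube :: "(real ^ 'd) set" where
  "unit_cube = {x. \<forall>j. 0 \<le> x $ j \<and> x $ j < 1}"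

text \<open>Elements of $L^2([0,1)^d)$ are given by representatives; their values off the cube never
  matter.\<close>

definition L2_cube :: "(real ^ 'd \<Rightarrow> real) set" where
  "L2_cube = {g. g \<in> borel_measurable (lebesgue_on unit_cube) \<and>
                 integrable (lebesgue_on unit_cube) (\<lambda>x. (g x)\<^sup>2)}"

definition L2_norm :: "(real ^ 'd \<Rightarrow> real) \<Rightarrow> real" where
  "L2_norm g = sqrt (integral\<^sup>L (lebesgue_on unit_cube) (\<lambda>x. (g x)\<^sup>2))"

text \<open>The classes of the members of \<open>G\<close> form a finite-dimensional subspace of $L^2$. Spanning is
  required only almost everywhere, so \<open>G\<close> may contain one or many representatives of a class.\<close>

definition fin_dim_L2_subspace :: "(real ^ 'd \<Rightarrow> real) set \<Rightarrow> bool" where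
  "fin_dim_L2_subspace G \<longleftrightarrow> subspace G \<and> G \<subseteq> L2_cube \<and>
     (\<exists>B. finite B \<and> B \<subseteq> G \<and>
        (\<forall>g\<in>G. \<exists>h\<in>span B. AE x in lebesgue_on unit_cube. g x = h x))"


definition grid :: "nat \<Rightarrow> (nat ^ 'd) set" where
  "grid n = {s. \<forall>j. s $ j \<in> {1..n}}"

definition cell :: "nat \<Rightarrow> nat ^ 'd \<Rightarrow> (real ^ 'd) set" where
  "cell n s = {x. \<forall>j. (real (s $ j) - 1) / real n \<le> x $ j \<and> x $ j < real (s $ j) / real n}"

text \<open>An element of $\mathbb{R}^{S^n}$ is a function on all multi-indices that vanishes outside
  \<^term>\<open>grid n\<close>; its Euclidean norm is \<^term>\<open>\<lambda>z. L2_set z (grid n)\<close>.\<close>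

definition delta :: "nat \<Rightarrow> (real ^ 'd \<Rightarrow> real) \<Rightarrow> nat ^ 'd \<Rightarrow> real" where
  "delta n g s =
     (if s \<in> grid n
      then real n ^ CARD('d) * set_lebesgue_integral lebesgue (cell n s) g
      else 0)"

definition iota :: "nat \<Rightarrow> (nat ^ 'd \<Rightarrow> real) \<Rightarrow> real ^ 'd \<Rightarrow> real" where
  "iota n z x = (\<Sum>s\<in>grid n. z s * indicator (cell n s) x)"

definition local_space ::
    "(real ^ 'd \<Rightarrow> real) set \<Rightarrow> nat \<Rightarrow> (nat ^ 'd) set \<Rightarrow> (nat ^ 'd \<Rightarrow> real) set" where
  "local_space G n P = (\<lambda>g s. indicator P s * delta n g s) ` G"

definition partition_space ::
    "(real ^ 'd \<Rightarrow> real) set \<Rightarrow> nat \<Rightarrow> (nat ^ 'd) set set \<Rightarrow> (nat ^ 'd \<Rightarrow> real) set" where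
  "partition_space G n Q = span (\<Union>P\<in>Q. local_space G n P)"

definition segmentations ::
    "(real ^ 'd \<Rightarrow> real) set \<Rightarrow> nat \<Rightarrow> (nat ^ 'd) set set set
       \<Rightarrow> ((nat ^ 'd) set set \<times> (nat ^ 'd \<Rightarrow> real)) set" where
  "segmentations G n \<PP> = {(Q, h). Q \<in> \<PP> \<and> h \<in> partition_space G n Q}"

definition penalized_fit ::
    "nat \<Rightarrow> real \<Rightarrow> (nat ^ 'd \<Rightarrow> real) \<Rightarrow> (nat ^ 'd) set set \<times> (nat ^ 'd \<Rightarrow> real) \<Rightarrow> real" where
  "penalized_fit n c y = (\<lambda>(Q, h).
     c * real (card Q) +
     (L2_set (\<lambda>s. h s - y s) (grid n))\<^sup>2 / real (card (grid n :: (nat ^ 'd) set)))"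

end

theory Submission
  imports Defs "HOL-Real_Asymp.Real_Asymp"
begin

text \<open>Almost surely, for all large \<open>n\<close> and simultaneously for all families \<open>A\<close> of fragments, the projection
  of the noise onto the span of the local spaces of \<open>A\<close> has squared norm at most
  $\rho \gamma_n |S^n| (|A| + k_0)$ with constants $\rho < 1$ and $k_0$. Applied to the union of the
  estimated partition and a competitor \<open>Q\<close>, the term $\gamma_n |S^n| |\hat P|$ cancels exactly against the
  penalty, and $\rho < 1$ leaves room to absorb the error of the estimator. The slack $\rho < 1$
  exists although the bound on $\gamma_n$ has none: a family of \<open>k\<close> fragments fails with probability about
  $|R|^{-k(1 + \epsilon)}$, there are only $\binom{|R|}{k}$ of them, and $k_0$ supplies the
  summability in \<open>n\<close>.\<close>

text \<open>The noise hypothesis controls one linear form at a time, whereas the estimated partition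
  depends on the noise. Hence norms of projections have to be bounded, uniformly over families, and
  with a rate arbitrarily close to 1/\<beta>: a fixed constant lost in the tail would break the
  threshold on \<gamma>. The losses are paid from the surplus 1/\<kappa> in (\<kappa> + 1)/\<kappa>.
  Spent on summability over n, this surplus would guarantee only failure probabilities of order 1/n,
  just short of summable. An additive constant k_0 in the noise bound does that job instead, at a
  price \<gamma>_n k_0 that tends to 0. The whole surplus is then free: one half covers the losses
  \<epsilon> in the tail rate and in \<rho>, the other half the factor that is exponential in the
  dimension.\<close>

section \<open>Orthonormal systems on a finite set and a deterministic least squares
  inequality\<close>

text \<open>Gram-Schmidt for the form given by summation over \<open>S\<close>. This form ignores
  values off \<open>S\<close>, so representations are claimed only on \<open>S\<close>, and a
  generator whose residual vanishes on \<open>S\<close> contributes no vector; \<open>B\<close> may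
  therefore be dependent.\<close>

lemma orthonormal_system_exists:
  fixes B :: "('i \<Rightarrow> real) set"
  assumes S: "finite S" and "finite B"
  shows "\<exists>m (e :: nat \<Rightarrow> 'i \<Rightarrow> real). m \<le> card B \<and>
           (\<forall>i<m. \<forall>j<m. (\<Sum>s\<in>S. e i s * e j s) = of_bool (i = j)) \<and>
           (\<forall>v\<in>span B. \<exists>c. \<forall>s\<in>S. v s = (\<Sum>i<m. c i * e i s))"
  using \<open>finite B\<close>
proof (induction B rule: finite_induct)
  case empty
  have "\<forall>v\<in>span ({} :: ('i \<Rightarrow> real) set). \<forall>s\<in>S. v s = (\<Sum>i<0::nat. 0)"
    by simp
  then show ?case
    by (intro exI[of _ 0]) auto
next
  case (insert b B)
  then obtain m :: nat and e :: "nat \<Rightarrow> 'i \<Rightarrow> real" where m: "m \<le> card B"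
    and on: "\<And>i j. i < m \<Longrightarrow> j < m \<Longrightarrow> (\<Sum>s\<in>S. e i s * e j s) = of_bool (i = j)"
    and sp: "\<And>v. v \<in> span B \<Longrightarrow> \<exists>c. \<forall>s\<in>S. v s = (\<Sum>i<m. c i * e i s)"
    by blast
  define \<beta> where "\<beta> i = (\<Sum>s\<in>S. b s * e i s)" for i
  define r where "r s = b s - (\<Sum>i<m. \<beta> i * e i s)" for s
  define q where "q = sqrt (\<Sum>s\<in>S. (r s)\<^sup>2)"
  have r_orth: "(\<Sum>s\<in>S. r s * e j s) = 0" if "j < m" for j
  proof -
    have "(\<Sum>s\<in>S. r s * e j s) = \<beta> j - (\<Sum>s\<in>S. \<Sum>i<m. \<beta> i * (e i s * e j s))"
      by (simp add: r_def \<beta>_def left_diff_distrib sum_subtractf sum_distrib_right mult.assoc)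
    also have "(\<Sum>s\<in>S. \<Sum>i<m. \<beta> i * (e i s * e j s)) = (\<Sum>i<m. \<beta> i * (\<Sum>s\<in>S. e i s * e j s))"
      by (subst sum.swap) (simp add: sum_distrib_left)
    also have "\<dots> = (\<Sum>i<m. \<beta> i * of_bool (i = j))"
      using that by (intro sum.cong) (simp_all add: on)
    also have "\<dots> = \<beta> j"
      using that by (simp add: of_bool_def if_distrib cong: if_cong)
    finally show ?thesis by simp
  qed
  have q2: "q\<^sup>2 = (\<Sum>s\<in>S. (r s)\<^sup>2)"
    by (simp add: q_def sum_nonneg)
  have extend: "\<forall>v\<in>span (insert b B). \<exists>c. \<forall>s\<in>S. v s = (\<Sum>i<m'. c i * e' i s)"
    if "\<forall>v\<in>insert b B. \<exists>c. \<forall>s\<in>S. v s = (\<Sum>i<m'. c i * e' i s)"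
    for m' and e' :: "nat \<Rightarrow> 'i \<Rightarrow> real"
  proof -
    \<comment> \<open>The representable functions form a subspace, so checking the generators
      suffices.\<close>
    let ?V = "{v. \<exists>c. \<forall>s\<in>S. v s = (\<Sum>i<m'. c i * e' i s)}"
    have "subspace ?V"
      unfolding subspace_def
    proof (intro conjI ballI allI)
      show "0 \<in> ?V"
        by (auto intro!: exI[of _ "\<lambda>_. 0"])
      show "x + y \<in> ?V" if xy: "x \<in> ?V" "y \<in> ?V" for x y
      proof -
        obtain c d where "\<forall>s\<in>S. x s = (\<Sum>i<m'. c i * e' i s)" "\<forall>s\<in>S. y s = (\<Sum>i<m'. d i * e' i s)"
          using xy by blast
        then have "\<forall>s\<in>S. (x + y) s = (\<Sum>i<m'. (c i + d i) * e' i s)"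
          by (simp add: distrib_right sum.distrib)
        then show ?thesis by (auto intro!: exI[of _ "\<lambda>i. c i + d i"])
      qed
      show "t *\<^sub>R x \<in> ?V" if x: "x \<in> ?V" for t x
      proof -
        obtain c where "\<forall>s\<in>S. x s = (\<Sum>i<m'. c i * e' i s)"
          using x by blast
        then have "\<forall>s\<in>S. (t *\<^sub>R x) s = (\<Sum>i<m'. (t * c i) * e' i s)"
          by (simp add: scaleR_fun_def sum_distrib_left mult.assoc)
        then show ?thesis by (auto intro!: exI[of _ "\<lambda>i. t * c i"])
      qed
    qed
    then have "span (insert b B) \<subseteq> ?V"
      using that by (intro span_minimal) auto
    then show ?thesis by blast
  qed
  show ?case
  proof (cases "q = 0")
    case True
    then have "\<forall>s\<in>S. r s = 0"
      using q2 S by (simp add: sum_nonneg_eq_0_iff)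
    then have "\<forall>v\<in>insert b B. \<exists>c. \<forall>s\<in>S. v s = (\<Sum>i<m. c i * e i s)"
      using sp by (auto simp: r_def span_base intro!: exI[of _ \<beta>])
    from extend[OF this] show ?thesis
      using m on insert.hyps by (intro exI[of _ m] exI[of _ e]) auto
  next
    case False
    define e' where "e' i = (if i = m then (\<lambda>s. r s / q) else e i)" for i
    have e'_less: "e' i = e i" if "i < m" for i
      using that by (simp add: e'_def)
    have e'_m: "e' m = (\<lambda>s. r s / q)"
      by (simp add: e'_def)
    have "(\<Sum>s\<in>S. e' m s * e' m s) = (\<Sum>s\<in>S. (r s)\<^sup>2) / q\<^sup>2"
      by (simp add: e'_m power2_eq_square sum_divide_distrib)
    then have mm: "(\<Sum>s\<in>S. e' m s * e' m s) = 1"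
      unfolding q2[symmetric] using False by simp
    have jm: "(\<Sum>s\<in>S. e' m s * e' j s) = 0" "(\<Sum>s\<in>S. e' j s * e' m s) = 0" if "j < m" for j
      using r_orth[OF that] that
      by (simp_all add: e'_m e'_less mult.commute flip: sum_divide_distrib)
    have on': "(\<Sum>s\<in>S. e' i s * e' j s) = of_bool (i = j)" if "i < Suc m" "j < Suc m" for i j
      using that mm jm on e'_less by (auto simp: less_Suc_eq)
    have "\<exists>c. \<forall>s\<in>S. v s = (\<Sum>i<Suc m. c i * e' i s)" if "v \<in> insert b B" for v
    proof (cases "v = b")
      case True
      have "v s = (\<Sum>i<Suc m. (\<beta>(m := q)) i * e' i s)" for s
      proof -
        have "(\<Sum>i<m. (\<beta>(m := q)) i * e' i s) = (\<Sum>i<m. \<beta> i * e i s)"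
          by (intro sum.cong) (auto simp: e'_less)
        moreover have "q * e' m s = b s - (\<Sum>i<m. \<beta> i * e i s)"
          using \<open>q \<noteq> 0\<close> unfolding e'_m r_def by simp
        ultimately show ?thesis
          using True by simp
      qed
      then show ?thesis by blast
    next
      case False
      then have "v \<in> span B"
        using that by (auto intro: span_base)
      then obtain c where c: "\<forall>s\<in>S. v s = (\<Sum>i<m. c i * e i s)"
        using sp by blast
      have "(\<Sum>i<Suc m. (c(m := 0)) i * e' i s) = (\<Sum>i<m. c i * e i s)" for s
      proof -
        have "(\<Sum>i<m. (c(m := 0)) i * e' i s) = (\<Sum>i<m. c i * e i s)"
          by (intro sum.cong) (auto simp: e'_less)
        then show ?thesis by simp
      qed
      with c have "\<forall>s\<in>S. v s = (\<Sum>i<Suc m. (c(m := 0)) i * e' i s)"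
        by metis
      then show ?thesis by blast
    qed
    then have "\<forall>v\<in>insert b B. \<exists>c. \<forall>s\<in>S. v s = (\<Sum>i<Suc m. c i * e' i s)"
      by blast
    from extend[OF this] show ?thesis
      using m on' insert.hyps by (intro exI[of _ "Suc m"] exI[of _ e']) auto
  qed
qed

text \<open>Parseval's identity. It turns the variance factor of the noise hypothesis into the
  squared length of a coefficient vector.\<close>

lemma orthonormal_sum_mult:
  fixes e :: "nat \<Rightarrow> 'i \<Rightarrow> real"
  assumes "\<And>i j. i < m \<Longrightarrow> j < m \<Longrightarrow> (\<Sum>s\<in>S. e i s * e j s) = of_bool (i = j)"
  shows "(\<Sum>s\<in>S. (\<Sum>i<m. c i * e i s)\<^sup>2) = (\<Sum>i<m. (c i)\<^sup>2)"
proof -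
  have "(\<Sum>s\<in>S. (\<Sum>i<m. c i * e i s)\<^sup>2) = (\<Sum>s\<in>S. \<Sum>i<m. \<Sum>j<m. c i * c j * (e i s * e j s))"
    by (simp add: power2_eq_square sum_product algebra_simps)
  also have "\<dots> = (\<Sum>i<m. \<Sum>s\<in>S. \<Sum>j<m. c i * c j * (e i s * e j s))"
    by (rule sum.swap)
  also have "\<dots> = (\<Sum>i<m. \<Sum>j<m. \<Sum>s\<in>S. c i * c j * (e i s * e j s))"
    by (intro sum.cong refl sum.swap)
  also have "\<dots> = (\<Sum>i<m. \<Sum>j<m. c i * c j * of_bool (i = j))"
    by (intro sum.cong refl) (simp add: assms flip: sum_distrib_left)
  also have "\<dots> = (\<Sum>i<m. (c i)\<^sup>2)"
    by (intro sum.cong) (simp_all add: power2_eq_square of_bool_def if_distrib cong: if_cong)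
  finally show ?thesis .
qed

text \<open>Here \<open>a\<close> is the truth, \<open>a + \<xi>\<close> the data, \<open>u\<close>
  the estimator, \<open>h\<close> a competitor, and \<open>p\<close>, \<open>q\<close> are their
  fragment counts. No bound on \<open>p\<close> is available, so it has to disappear from the
  conclusion.\<close>

lemma penalized_least_squares_bound:
  fixes u h a \<xi> :: "'i \<Rightarrow> real"
  assumes \<epsilon>: "0 < \<epsilon>" "\<epsilon> < 1" and "0 \<le> p" "0 \<le> q" "0 \<le> k0" "0 \<le> c"
    and opt: "c * p + (\<Sum>s\<in>S. (u s - (a s + \<xi> s))\<^sup>2) \<le> c * q + (\<Sum>s\<in>S. (h s - (a s + \<xi> s))\<^sup>2)"
    and noise: "(\<Sum>s\<in>S. (u s - h s) * \<xi> s)\<^sup>2 \<le> (\<Sum>s\<in>S. (u s - h s)\<^sup>2) * ((1 - \<epsilon>) * (c * (p + q + k0)))"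
  shows "\<epsilon>\<^sup>2 * (\<Sum>s\<in>S. (u s - a s)\<^sup>2) \<le> c * (2 * q + k0) + (1 + 1 / \<epsilon>) * (\<Sum>s\<in>S. (h s - a s)\<^sup>2)"
proof -
  define U H W I where "U = (\<Sum>s\<in>S. (u s - a s)\<^sup>2)" and "H = (\<Sum>s\<in>S. (h s - a s)\<^sup>2)"
    and "W = (\<Sum>s\<in>S. (u s - h s)\<^sup>2)" and "I = (\<Sum>s\<in>S. (u s - h s) * \<xi> s)"
  define Z where "Z = c * (p + q + k0)"
  have nonneg: "0 \<le> U" "0 \<le> H" "0 \<le> W" "0 \<le> Z"
    using assms by (auto simp: U_def H_def W_def Z_def sum_nonneg)
  have "(\<Sum>s\<in>S. (u s - (a s + \<xi> s))\<^sup>2) - (\<Sum>s\<in>S. (h s - (a s + \<xi> s))\<^sup>2) = U - H - 2 * I"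
    by (simp add: U_def H_def I_def power2_eq_square algebra_simps sum_distrib_left
        flip: sum_subtractf sum.distrib)
  with opt have 1: "U \<le> H + c * q - c * p + 2 * I"
    by linarith
  \<comment> \<open>In this arithmetic-geometric mean step the factor \<open>1 - \<epsilon>\<close>
    goes entirely to \<open>W\<close>. So \<open>Z\<close> keeps coefficient 1, and its part
    \<open>c * p\<close> is exactly what the penalty subtracts.\<close>
  have "(2 * I)\<^sup>2 \<le> 4 * ((1 - \<epsilon>) * W * Z)"
    using noise by (simp add: I_def W_def Z_def power_mult_distrib mult_ac)
  also have "\<dots> \<le> ((1 - \<epsilon>) * W + Z)\<^sup>2"
    using zero_le_power2[of "(1 - \<epsilon>) * W - Z"] by (simp add: power2_eq_square algebra_simps)
  finally have 2: "2 * I \<le> (1 - \<epsilon>) * W + Z"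
    by (rule power2_le_imp_le) (use nonneg \<epsilon> in auto)
  \<comment> \<open>Young's inequality with weight \<epsilon>: the coefficient of the estimator's
    error becomes (1 - \<epsilon>)(1 + \<epsilon>) = 1 - \<epsilon>^2, just below 1, so that error
    can be absorbed on the left.\<close>
  have "(u s - h s)\<^sup>2 \<le> (1 + \<epsilon>) * (u s - a s)\<^sup>2 + (1 + 1 / \<epsilon>) * (h s - a s)\<^sup>2" for s
  proof -
    have "0 \<le> (\<epsilon> * (u s - a s) + (h s - a s))\<^sup>2 / \<epsilon>"
      using \<epsilon> by simp
    also have "\<dots> = (1 + \<epsilon>) * (u s - a s)\<^sup>2 + (1 + 1 / \<epsilon>) * (h s - a s)\<^sup>2 - (u s - h s)\<^sup>2"
      using \<epsilon> by (simp add: field_simps power2_eq_square)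
    finally show ?thesis by simp
  qed
  then have "W \<le> (\<Sum>s\<in>S. (1 + \<epsilon>) * (u s - a s)\<^sup>2 + (1 + 1 / \<epsilon>) * (h s - a s)\<^sup>2)"
    unfolding W_def by (rule sum_mono)
  also have "\<dots> = (1 + \<epsilon>) * U + (1 + 1 / \<epsilon>) * H"
    by (simp add: U_def H_def sum.distrib sum_distrib_left)
  finally have "(1 - \<epsilon>) * W \<le> (1 - \<epsilon>) * ((1 + \<epsilon>) * U + (1 + 1 / \<epsilon>) * H)"
    using \<epsilon> by (intro mult_left_mono) auto
  also have "\<dots> = (1 - \<epsilon>\<^sup>2) * U + (1 / \<epsilon> - \<epsilon>) * H"
    using \<epsilon> by (simp add: field_simps power2_eq_square)
  also have "\<dots> \<le> (1 - \<epsilon>\<^sup>2) * U + 1 / \<epsilon> * H"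
    using \<epsilon> nonneg by (simp add: left_diff_distrib)
  finally have "U \<le> H + c * q - c * p + ((1 - \<epsilon>\<^sup>2) * U + 1 / \<epsilon> * H) + Z"
    using 1 2 by linarith
  then show ?thesis
    by (simp add: Z_def U_def[symmetric] H_def[symmetric] algebra_simps)
qed

section \<open>Tail of the norm of a subgaussian vector\<close>

text \<open>The bound does not depend on \<open>b\<close>, so the size of the clamping box leaves no
  trace in the tail bound. Both one-sided series count 0, whence 2 in place of 1 + q.\<close>

lemma sum_geometric_abs_le:
  fixes q :: real
  assumes "0 \<le> q" "q < 1"
  shows "(\<Sum>j\<in>{- int b..int b}. q ^ nat \<bar>j\<bar>) \<le> 2 / (1 - q)"
proof -
  have "j \<in> (\<lambda>j. - int j) ` {..b} \<union> int ` {..b}" if "j \<in> {- int b..int b}" for j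
  proof (cases "0 \<le> j")
    case True
    then have "j = int (nat j)" "nat j \<in> {..b}"
      using that by auto
    then show ?thesis by (intro UnI2 image_eqI)
  next
    case False
    then have "j = - int (nat (- j))" "nat (- j) \<in> {..b}"
      using that by auto
    then show ?thesis by (intro UnI1 image_eqI)
  qed
  then have "{- int b..int b} \<subseteq> (\<lambda>j. - int j) ` {..b} \<union> int ` {..b}"
    by blast
  then have "(\<Sum>j\<in>{- int b..int b}. q ^ nat \<bar>j\<bar>)
      \<le> (\<Sum>j\<in>(\<lambda>j. - int j) ` {..b} \<union> int ` {..b}. q ^ nat \<bar>j\<bar>)"
    using assms by (intro sum_mono2) auto
  also have "\<dots> \<le> (\<Sum>j\<in>(\<lambda>j. - int j) ` {..b}. q ^ nat \<bar>j\<bar>) + (\<Sum>j\<in>int ` {..b}. q ^ nat \<bar>j\<bar>)"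
    using assms by (subst sum.union_inter[symmetric]) (auto intro!: sum_nonneg)
  also have "\<dots> = 2 * (\<Sum>j\<le>b. q ^ j)"
    by (subst (1 2) sum.reindex) (auto simp: inj_on_def)
  also have "(\<Sum>j\<le>b. q ^ j) \<le> (\<Sum>j. q ^ j)"
    using assms by (intro sum_le_suminf summable_geometric) auto
  also have "(\<Sum>j. q ^ j) = 1 / (1 - q)"
    using assms by (intro suminf_geometric) auto
  finally show ?thesis by simp
qed

text \<open>Rounding towards zero, then clamping to the box. The first inequality, summed over
  coordinates, bounds the inner product with the rounded vector below by its squared norm; the
  second says that at most 1 is lost unless the clamp is reached.\<close>

lemma exists_rounding:
  fixes y :: real
  shows "\<exists>j\<in>{- int b..int b}. (of_int j)\<^sup>2 \<le> of_int j * y \<and> (\<bar>y\<bar> \<le> \<bar>of_int j\<bar> + 1 \<or> \<bar>j\<bar> = int b)"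
proof -
  have *: "\<exists>j\<in>{0..int b}. (of_int j)\<^sup>2 \<le> of_int j * y \<and> (y \<le> of_int j + 1 \<or> j = int b)" if "0 \<le> y" for y :: real
  proof (cases "\<lfloor>y\<rfloor> \<le> int b")
    case True
    have "of_int \<lfloor>y\<rfloor> * of_int \<lfloor>y\<rfloor> \<le> of_int \<lfloor>y\<rfloor> * y"
      using that by (intro mult_left_mono) auto
    then show ?thesis
      using True that by (intro bexI[of _ "\<lfloor>y\<rfloor>"]) (auto simp: power2_eq_square)
  next
    case False
    then have "int b \<le> y" by linarith
    then show ?thesis
      by (intro bexI[of _ "int b"]) (auto simp: power2_eq_square intro!: mult_left_mono)
  qed
  show ?thesis
  proof (cases "0 \<le> y")
    case True
    from *[OF this] obtain j where "j\<in>{0..int b}" "(of_int j)\<^sup>2 \<le> of_int j * y" "y \<le> of_int j + 1 \<or> j = int b"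
      by blast
    then show ?thesis using True by (intro bexI[of _ j]) auto
  next
    case False
    then have "0 \<le> -y" by simp
    from *[OF this] obtain j where "j\<in>{0..int b}" "(of_int j)\<^sup>2 \<le> of_int j * (-y)" "-y \<le> of_int j + 1 \<or> j = int b"
      by blast
    then show ?thesis using False by (intro bexI[of _ "-j"]) auto
  qed
qed

text \<open>Round $X / \sqrt{\beta}$ towards zero to an integer vector \<open>k\<close>, clamped to a finite box. Then
  $\langle k, X \rangle \ge \sqrt{\beta} |k|^2$, which has probability at most $2 e^{-|k|^2}$, so summing over
  \<open>k\<close> loses only a factor exponential in the dimension and keeps the rate arbitrarily close to
  $1 / \beta$.\<close>

lemma (in prob_space) subgaussian_norm_tail:
  fixes X :: "nat \<Rightarrow> 'a \<Rightarrow> real"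
  assumes "0 < \<beta>" "0 < \<epsilon>" "\<epsilon> < 1"
    and X [measurable]: "\<And>i. i < m \<Longrightarrow> X i \<in> borel_measurable M"
    and tail: "\<And>\<mu> c. 0 \<le> c \<Longrightarrow>
      prob {\<omega> \<in> space M. c \<le> \<bar>\<Sum>i<m. \<mu> i * X i \<omega>\<bar>} \<le> 2 * exp (- (c\<^sup>2 / (\<beta> * (\<Sum>i<m. (\<mu> i)\<^sup>2))))"
  shows "prob {\<omega> \<in> space M. T \<le> (\<Sum>i<m. (X i \<omega>)\<^sup>2)}
    \<le> 2 * exp (real m * (ln (2 / (1 - exp (- \<epsilon>))) + (1 - \<epsilon>) / \<epsilon>) - (1 - \<epsilon>) / (1 + \<epsilon>) * (T / \<beta>))"
proof -
  \<comment> \<open>The box is so large that a single coordinate at its boundary already gives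
    \<open>sq k\<close> at least \<open>T / \<beta>\<close>. The summand 1 ensures that
    \<open>b\<close> is at most its square.\<close>
  obtain b :: nat where "1 + max 0 (T / \<beta>) \<le> real b"
    using real_arch_simple by blast
  then have "1 \<le> real b" "T / \<beta> \<le> real b"
    by linarith+
  moreover from this(1) have "real b \<le> (real b)\<^sup>2"
    by (simp add: power2_eq_square)
  ultimately have b: "T \<le> \<beta> * (real b)\<^sup>2"
    using \<open>0 < \<beta>\<close> by (simp add: pos_divide_le_eq mult.commute order_trans[OF _ mult_left_mono])
  define Z where "Z = ({..<m} \<rightarrow>\<^sub>E {- int b..int b})"
  define sq where "sq k = (\<Sum>i<m. (real_of_int (k i))\<^sup>2)" for k :: "nat \<Rightarrow> int"
  \<comment> \<open>Without clamping, each squared coordinate of \<open>y\<close> is at most (x +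
    1)^2 <= (1 + \<epsilon>) x^2 + (1 + \<epsilon>)/\<epsilon>, where x is the modulus of the
    rounded coordinate. Summing and solving for \<open>sq k\<close> gives this threshold.\<close>
  define t where "t = T / ((1 + \<epsilon>) * \<beta>) - real m / \<epsilon>"
  define K where "K = {k \<in> Z. t \<le> sq k}"
  define E where "E k = {\<omega> \<in> space M. sqrt \<beta> * sq k \<le> \<bar>\<Sum>i<m. real_of_int (k i) * X i \<omega>\<bar>}" for k
  have fin: "finite Z" "finite K"
    by (auto simp: Z_def K_def finite_PiE)
  have sq_nonneg: "0 \<le> sq k" for k
    by (simp add: sq_def sum_nonneg)
  have E_sets [measurable]: "E k \<in> events" for k
    unfolding E_def by measurable
  have cover: "{\<omega> \<in> space M. T \<le> (\<Sum>i<m. (X i \<omega>)\<^sup>2)} \<subseteq> (\<Union>k\<in>K. E k)"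
  proof
    fix \<omega> assume "\<omega> \<in> {\<omega> \<in> space M. T \<le> (\<Sum>i<m. (X i \<omega>)\<^sup>2)}"
    then have \<omega>: "\<omega> \<in> space M" and T: "T \<le> (\<Sum>i<m. (X i \<omega>)\<^sup>2)" by auto
    define y where "y i = X i \<omega> / sqrt \<beta>" for i
    have Xy: "X i \<omega> = sqrt \<beta> * y i" for i
      using \<open>0 < \<beta>\<close> by (simp add: y_def)
    have "\<forall>i. \<exists>j\<in>{- int b..int b}. (of_int j)\<^sup>2 \<le> of_int j * y i \<and>
        (\<bar>y i\<bar> \<le> \<bar>of_int j\<bar> + 1 \<or> \<bar>j\<bar> = int b)"
      using exists_rounding by blast
    then obtain k0 where k0: "\<And>i. k0 i \<in> {- int b..int b}"
      "\<And>i. (of_int (k0 i))\<^sup>2 \<le> of_int (k0 i) * y i"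
      "\<And>i. \<bar>y i\<bar> \<le> \<bar>of_int (k0 i)\<bar> + 1 \<or> \<bar>k0 i\<bar> = int b"
      by metis
    define k where "k = restrict k0 {..<m}"
    have kZ: "k \<in> Z"
      using k0(1) by (auto simp: k_def Z_def)
    have sqk: "sq k = (\<Sum>i<m. (real_of_int (k0 i))\<^sup>2)"
      by (simp add: sq_def k_def)
    have "sqrt \<beta> * sq k \<le> sqrt \<beta> * (\<Sum>i<m. of_int (k0 i) * y i)"
      using \<open>0 < \<beta>\<close> unfolding sqk by (intro mult_left_mono sum_mono k0(2)) auto
    also have "\<dots> = (\<Sum>i<m. real_of_int (k i) * X i \<omega>)"
      by (simp add: k_def Xy sum_distrib_left mult_ac)
    finally have "\<omega> \<in> E k"
      using \<omega> unfolding E_def by auto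
    moreover have "t \<le> sq k"
    proof (cases "\<exists>i<m. \<bar>k0 i\<bar> = int b")
      case True
      then obtain i where i: "i < m" "\<bar>k0 i\<bar> = int b" by blast
      have "(real b)\<^sup>2 = (real_of_int (k0 i))\<^sup>2"
        using i(2) by (metis of_int_abs of_int_of_nat_eq power2_abs)
      also have "\<dots> \<le> sq k"
        unfolding sqk using i(1) by (intro member_le_sum) auto
      finally have "(real b)\<^sup>2 \<le> sq k" .
      have "t \<le> T / ((1 + \<epsilon>) * \<beta>)"
        using assms by (simp add: t_def)
      also have "\<dots> \<le> sq k"
      proof -
        have "T \<le> \<beta> * sq k"
          using b \<open>(real b)\<^sup>2 \<le> sq k\<close> \<open>0 < \<beta>\<close>
          by (meson mult_left_mono order_trans less_imp_le)
        also have "\<dots> \<le> (1 + \<epsilon>) * (\<beta> * sq k)"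
          using assms(1,2) sq_nonneg[of k] by (simp add: distrib_right)
        finally show ?thesis
          using assms(1,2) by (simp add: pos_divide_le_eq mult_ac)
      qed
      finally show ?thesis .
    next
      case False
      have y2: "(y i)\<^sup>2 \<le> (1 + \<epsilon>) * (of_int (k0 i))\<^sup>2 + (1 + 1 / \<epsilon>)" if "i < m" for i
      proof -
        define x where "x = \<bar>real_of_int (k0 i)\<bar>"
        have "\<bar>y i\<bar>\<^sup>2 \<le> (x + 1)\<^sup>2"
          using k0(3)[of i] that False by (intro power_mono) (auto simp: x_def)
        also have "\<dots> \<le> (x + 1)\<^sup>2 + (\<epsilon> * x - 1)\<^sup>2 / \<epsilon>"
          using assms by simp
        also have "\<dots> = (1 + \<epsilon>) * x\<^sup>2 + (1 + 1 / \<epsilon>)"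
          using assms by (simp add: field_simps power2_eq_square)
        finally show ?thesis by (simp add: x_def)
      qed
      have "T \<le> \<beta> * (\<Sum>i<m. (y i)\<^sup>2)"
        using T \<open>0 < \<beta>\<close> by (simp add: Xy power_mult_distrib sum_distrib_left)
      also have "\<dots> \<le> \<beta> * (\<Sum>i<m. (1 + \<epsilon>) * (of_int (k0 i))\<^sup>2 + (1 + 1 / \<epsilon>))"
        using \<open>0 < \<beta>\<close> y2 by (intro mult_left_mono sum_mono) auto
      also have "\<dots> = (1 + \<epsilon>) * \<beta> * (sq k + real m / \<epsilon>)"
        unfolding sum.distrib sum_distrib_left[symmetric] sqk[symmetric]
        using \<open>0 < \<epsilon>\<close> by (simp add: field_simps)
      finally show ?thesis
        unfolding t_def using assms(1,2) by (simp only: diff_le_eq) (subst pos_divide_le_eq, simp_all add: mult_ac)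
    qed
    ultimately show "\<omega> \<in> (\<Union>k\<in>K. E k)"
      using kZ by (auto simp: K_def)
  qed
  define S where "S = 2 / (1 - exp (- \<epsilon>))"
  have S: "0 < S"
    using assms by (simp add: S_def)
  have probE: "prob (E k) \<le> 2 * exp (- ((1 - \<epsilon>) * t)) * (\<Prod>i<m. exp (- \<epsilon>) ^ nat \<bar>k i\<bar>)" if "k \<in> K" for k
  proof -
    have "prob (E k) \<le> 2 * exp (- ((sqrt \<beta> * sq k)\<^sup>2 / (\<beta> * sq k)))"
      unfolding E_def sq_def using \<open>0 < \<beta>\<close> by (intro tail) (simp add: sum_nonneg)
    \<comment> \<open>For \<open>sq k = 0\<close> both sides are 0 because division by zero yields
      0; the tail bound is then the trivial value 2.\<close>
    also have "(sqrt \<beta> * sq k)\<^sup>2 / (\<beta> * sq k) = sq k"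
      using \<open>0 < \<beta>\<close> by (simp add: power_mult_distrib) (simp add: power2_eq_square)
    \<comment> \<open>The main share of the exponent is kept for the threshold \<open>t\<close>. The
      small share \<epsilon> makes the sum over all lattice points converge: it factors over the
      coordinates, and an integer's square dominates its modulus, which leaves geometric
      series.\<close>
    also have "- sq k = - ((1 - \<epsilon>) * sq k) + (\<Sum>i<m. - \<epsilon> * (of_int (k i))\<^sup>2)"
      by (simp add: sum_distrib_left[symmetric] sum_negf flip: sq_def) (simp add: algebra_simps)
    also have "exp \<dots> = exp (- ((1 - \<epsilon>) * sq k)) * (\<Prod>i<m. exp (- \<epsilon> * (of_int (k i))\<^sup>2))"
      by (simp only: exp_add exp_sum[OF finite_lessThan])
    also have "\<dots> \<le> exp (- ((1 - \<epsilon>) * t)) * (\<Prod>i<m. exp (- \<epsilon>) ^ nat \<bar>k i\<bar>)"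
    proof (intro mult_mono prod_mono conjI)
      show "exp (- ((1 - \<epsilon>) * sq k)) \<le> exp (- ((1 - \<epsilon>) * t))"
        using that assms by (simp add: K_def mult_left_mono)
      show "exp (- \<epsilon> * (real_of_int (k i))\<^sup>2) \<le> exp (- \<epsilon>) ^ nat \<bar>k i\<bar>" for i
      proof -
        have "\<bar>k i\<bar> * 1 \<le> \<bar>k i\<bar> * \<bar>k i\<bar>"
          by (cases "k i = 0") (simp, intro mult_left_mono, linarith+)
        then have "real_of_int \<bar>k i\<bar> \<le> real_of_int (\<bar>k i\<bar> * \<bar>k i\<bar>)"
          by (simp only: of_int_le_iff)
        then have "real (nat \<bar>k i\<bar>) \<le> (real_of_int (k i))\<^sup>2"
          by (simp add: power2_eq_square)
        then show ?thesis
          using assms by (simp flip: exp_of_nat_mult)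
      qed
    qed (auto intro!: prod_nonneg)
    finally show ?thesis by simp
  qed
  have "prob {\<omega> \<in> space M. T \<le> (\<Sum>i<m. (X i \<omega>)\<^sup>2)} \<le> prob (\<Union>k\<in>K. E k)"
    using cover fin by (intro finite_measure_mono) auto
  also have "\<dots> \<le> (\<Sum>k\<in>K. prob (E k))"
    using fin by (intro finite_measure_subadditive_finite) auto
  also have "\<dots> \<le> (\<Sum>k\<in>K. 2 * exp (- ((1 - \<epsilon>) * t)) * (\<Prod>i<m. exp (- \<epsilon>) ^ nat \<bar>k i\<bar>))"
    by (intro sum_mono probE)
  also have "\<dots> \<le> (\<Sum>k\<in>Z. 2 * exp (- ((1 - \<epsilon>) * t)) * (\<Prod>i<m. exp (- \<epsilon>) ^ nat \<bar>k i\<bar>))"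
    using fin by (intro sum_mono2) (auto simp: K_def intro!: mult_nonneg_nonneg prod_nonneg)
  also have "\<dots> = 2 * exp (- ((1 - \<epsilon>) * t)) * (\<Prod>i<m. \<Sum>j\<in>{- int b..int b}. exp (- \<epsilon>) ^ nat \<bar>j\<bar>)"
    unfolding Z_def by (subst prod_sum_PiE) (auto simp: sum_distrib_left)
  also have "\<dots> \<le> 2 * exp (- ((1 - \<epsilon>) * t)) * S ^ m"
    using assms sum_geometric_abs_le[of "exp (- \<epsilon>)" b]
    by (auto simp: S_def intro!: mult_left_mono power_mono sum_nonneg)
  also have "\<dots> = 2 * exp (real m * ln S - (1 - \<epsilon>) * t)"
    using S exp_of_nat_mult[of m "ln S"] by (simp add: exp_diff exp_minus divide_inverse)
  also have "real m * ln S - (1 - \<epsilon>) * t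
      = real m * (ln S + (1 - \<epsilon>) / \<epsilon>) - (1 - \<epsilon>) / (1 + \<epsilon>) * (T / \<beta>)"
    using assms by (simp add: t_def algebra_simps)
  finally show ?thesis
    by (simp add: S_def)
qed

section \<open>Cells, the grid and the L2 norm of step functions\<close>

lemma cell_bounds:
  fixes s :: "nat ^ 'd::finite"
  shows "box (\<chi> j. (real (s $ j) - 1) / real n) (\<chi> j. real (s $ j) / real n) \<subseteq> cell n s"
    and "cell n s \<subseteq> cbox (\<chi> j. (real (s $ j) - 1) / real n) (\<chi> j. real (s $ j) / real n)"
  by (auto simp: cell_def mem_box_cart less_imp_le)

lemma cell_sets_borel [measurable]: "cell n s \<in> sets borel"
  unfolding cell_def by measurable

lemma unit_cube_sets_borel [measurable]: "unit_cube \<in> sets borel"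
  unfolding unit_cube_def by measurable

text \<open>The half-open cell lies between an open and a closed box of equal volume.\<close>

lemma emeasure_cell:
  fixes s :: "nat ^ 'd::finite"
  assumes "0 < n"
  shows "emeasure lborel (cell n s) = 1 / real n ^ CARD('d)"
proof -
  let ?a = "\<chi> j. (real (s $ j) - 1) / real n" and ?b = "\<chi> j. real (s $ j) / real n"
  have le: "\<And>b. b \<in> Basis \<Longrightarrow> ?a \<bullet> b \<le> ?b \<bullet> b"
    using assms by (auto simp: Basis_vec_def inner_axis divide_right_mono)
  have "measure lborel (cbox ?a ?b) = (\<Prod>i\<in>(UNIV :: 'd set). 1 / real n)"
    using le
    by (subst content_cbox_cart) (auto simp: box_ne_empty diff_divide_distrib[symmetric])
  then have c: "(\<Prod>b\<in>Basis. (?b - ?a) \<bullet> b) = 1 / real n ^ CARD('d)"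
    using le by (simp add: content_cbox power_one_over)
  have "emeasure lborel (cell n s) \<le> emeasure lborel (cbox ?a ?b)"
    by (intro emeasure_mono cell_bounds) auto
  moreover have "emeasure lborel (box ?a ?b) \<le> emeasure lborel (cell n s)"
    by (intro emeasure_mono cell_bounds) auto
  ultimately show ?thesis
    using le c by (simp add: emeasure_lborel_box emeasure_lborel_cbox)
qed

lemma cell_subset_unit_cube:
  assumes "s \<in> grid n"
  shows "cell n s \<subseteq> unit_cube"
proof
  fix x assume x: "x \<in> cell n s"
  have "0 \<le> x $ j \<and> x $ j < 1" for j
  proof -
    have s: "1 \<le> s $ j" "s $ j \<le> n"
      using assms by (auto simp: grid_def)
    have "0 \<le> (real (s $ j) - 1) / real n" "real (s $ j) / real n \<le> 1"
      using s by (auto simp: divide_le_eq)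
    then show ?thesis
      using x by (auto simp: cell_def intro: order_trans less_le_trans)
  qed
  then show "x \<in> unit_cube"
    by (simp add: unit_cube_def)
qed

lemma cell_disjoint:
  assumes "0 < n" "x \<in> cell n s" "x \<in> cell n t"
  shows "s = t"
proof -
  have "s $ j = t $ j" for j
  proof -
    have "real (s $ j) - 1 \<le> real n * x $ j" "real n * x $ j < real (s $ j)"
      "real (t $ j) - 1 \<le> real n * x $ j" "real n * x $ j < real (t $ j)"
      using assms by (auto simp: cell_def field_simps)
    then show ?thesis by linarith
  qed
  then show ?thesis by (simp add: vec_eq_iff)
qed

lemma finite_grid: "finite (grid n :: (nat ^ 'd::finite) set)"
  and card_grid: "card (grid n :: (nat ^ 'd::finite) set) = n ^ CARD('d)"
proof -
  have eq: "(grid n :: (nat ^ 'd) set) = vec_lambda ` (UNIV \<rightarrow>\<^sub>E {1..n})"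
  proof (intro equalityI subsetI)
    fix s :: "nat ^ 'd" assume "s \<in> grid n"
    then show "s \<in> vec_lambda ` (UNIV \<rightarrow>\<^sub>E {1..n})"
      by (intro image_eqI[of _ _ "\<lambda>j. s $ j"]) (auto simp: grid_def)
  qed (auto simp: grid_def PiE_iff)
  show "finite (grid n :: (nat ^ 'd) set)"
    unfolding eq by (intro finite_imageI finite_PiE) auto
  have "inj (vec_lambda :: ('d \<Rightarrow> nat) \<Rightarrow> nat ^ 'd)"
    by (metis injI vec_lambda_inverse UNIV_I)
  then show "card (grid n :: (nat ^ 'd) set) = n ^ CARD('d)"
    unfolding eq by (subst card_image) (auto simp: card_PiE intro: inj_on_subset)
qed

lemma finite_measure_unit_cube: "finite_measure (lebesgue_on (unit_cube :: (real ^ 'd::finite) set))"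
proof
  have "unit_cube \<subseteq> cbox 0 (1 :: real ^ 'd)"
    by (auto simp: unit_cube_def mem_box_cart less_imp_le)
  then have "emeasure lborel (unit_cube :: (real ^ 'd) set) \<le> emeasure lborel (cbox 0 (1 :: real ^ 'd))"
    by (intro emeasure_mono) auto
  then have "emeasure lborel (unit_cube :: (real ^ 'd) set) < \<infinity>"
    using emeasure_lborel_cbox_finite le_less_trans by blast
  then show "emeasure (lebesgue_on unit_cube) (space (lebesgue_on (unit_cube :: (real ^ 'd) set))) \<noteq> \<infinity>"
    by (simp add: emeasure_restrict_space)
qed

lemma L2_cube_integrable:
  fixes f :: "real ^ 'd::finite \<Rightarrow> real"
  assumes "f \<in> L2_cube"
  shows "integrable (lebesgue_on unit_cube) f"
proof -
  interpret finite_measure "lebesgue_on (unit_cube :: (real ^ 'd::finite) set)"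
    by (rule finite_measure_unit_cube)
  show ?thesis
    by (rule square_integrable_imp_integrable) (use assms in \<open>simp_all add: L2_cube_def\<close>)
qed

lemma iota_apply:
  assumes "0 < n" "s \<in> grid n" "x \<in> cell n s"
  shows "iota n z x = z s"
proof -
  have "iota n z x = (\<Sum>t\<in>grid n. if t = s then z s else 0)"
    unfolding iota_def
  proof (intro sum.cong refl)
    fix t
    have "x \<in> cell n t \<longleftrightarrow> t = s"
      using cell_disjoint[OF assms(1), of x t s] assms(3) by blast
    then show "z t * indicator (cell n t) x = (if t = s then z s else 0)"
      using assms(3) by simp
  qed
  then show ?thesis
    using assms(2) by (simp add: finite_grid)
qed

text \<open>\<^term>\<open>iota n (delta n f)\<close> is the orthogonal projection of \<^term>\<open>f\<close> onto the step functions.\<close>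

lemma L2_norm_iota_diff:
  fixes f :: "real ^ 'd::finite \<Rightarrow> real"
  assumes f: "f \<in> L2_cube" and n: "0 < n"
  shows "(L2_norm (\<lambda>x. iota n h x - f x))\<^sup>2 =
    (\<Sum>s\<in>grid n. (h s - delta n f s)\<^sup>2) / real (card (grid n :: (nat ^ 'd) set)) +
    (L2_norm (\<lambda>x. iota n (delta n f) x - f x))\<^sup>2"
proof -
  let ?\<mu> = "lebesgue_on (unit_cube :: (real ^ 'd) set)"
  let ?N = "real n ^ CARD('d)"
  interpret finite_measure ?\<mu>
    by (rule finite_measure_unit_cube)
  have f_int: "integrable ?\<mu> f" and f2_int: "integrable ?\<mu> (\<lambda>x. (f x)\<^sup>2)"
    and f_meas [measurable]: "f \<in> borel_measurable ?\<mu>"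
    using f L2_cube_integrable by (auto simp: L2_cube_def)
  have cell_meas [measurable]: "cell n s \<in> sets lebesgue" for s :: "nat ^ 'd"
    by simp
  define a where "a = delta n f"
  define g where "g x = iota n a x - f x" for x
  define z where "z s = h s - a s" for s
  have ind_meas [measurable]: "(indicator (cell n s) :: real ^ 'd \<Rightarrow> real) \<in> borel_measurable ?\<mu>" for s
    by (intro measurable_restrict_space1) simp
  have ind_mult: "integrable ?\<mu> (\<lambda>x. indicator (cell n s) x * u x)" if "integrable ?\<mu> u"
    for s and u :: "real ^ 'd \<Rightarrow> real"
    by (rule Bochner_Integration.integrable_bound[OF that])
       (use borel_measurable_integrable[OF that] in measurable, auto simp: indicator_def)
  have iota_meas [measurable]: "iota n y \<in> borel_measurable ?\<mu>" for y
    unfolding iota_def by measurable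
  have iota_bound: "\<bar>iota n y x\<bar> \<le> (\<Sum>s\<in>grid n. \<bar>y s\<bar>)" for y and x :: "real ^ 'd"
    unfolding iota_def by (intro order_trans[OF sum_abs] sum_mono) (auto simp: indicator_def)
  have iota_int: "integrable ?\<mu> (iota n y)" for y
    using iota_bound by (intro integrable_const_bound[of _ "\<Sum>s\<in>grid n. \<bar>y s\<bar>"]) auto
  have g_int: "integrable ?\<mu> g"
    unfolding g_def by (intro Bochner_Integration.integrable_diff iota_int f_int)
  have iota_sq_int: "integrable ?\<mu> (\<lambda>x. (iota n y x)\<^sup>2)" for y
    using power_mono[OF iota_bound abs_ge_zero, of _ _ 2]
    by (intro integrable_const_bound[of _ "(\<Sum>s\<in>grid n. \<bar>y s\<bar>)\<^sup>2"]) auto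
  have g2_int: "integrable ?\<mu> (\<lambda>x. (g x)\<^sup>2)"
  proof (rule Bochner_Integration.integrable_bound)
    show "integrable ?\<mu> (\<lambda>x. 2 * (iota n a x)\<^sup>2 + 2 * (f x)\<^sup>2)"
      by (intro Bochner_Integration.integrable_add integrable_mult_right iota_sq_int f2_int)
    have "(u - v)\<^sup>2 \<le> 2 * u\<^sup>2 + 2 * v\<^sup>2" for u v :: real
      using zero_le_power2[of "u + v"] by (simp add: power2_eq_square algebra_simps)
    then show "AE x in ?\<mu>. norm ((g x)\<^sup>2) \<le> norm (2 * (iota n a x)\<^sup>2 + 2 * (f x)\<^sup>2)"
      by (simp add: g_def)
  qed (simp add: g_def)
  have int_cell: "integral\<^sup>L ?\<mu> (\<lambda>x. indicator (cell n s) x * u x) = set_lebesgue_integral lebesgue (cell n s) u"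
    if "s \<in> grid n" for s and u :: "real ^ 'd \<Rightarrow> real"
    using cell_subset_unit_cube[OF that]
    by (subst integral_restrict_space)
       (auto simp: set_lebesgue_integral_def indicator_def intro!: Bochner_Integration.integral_cong)
  have int_one: "integral\<^sup>L ?\<mu> (indicator (cell n s)) = 1 / ?N" if "s \<in> grid n" for s
  proof -
    have "integral\<^sup>L ?\<mu> (\<lambda>x. indicator (cell n s) x * 1) = measure lebesgue (cell n s)"
      using emeasure_cell[OF n, of s] unfolding int_cell[OF that]
      by (simp add: set_lebesgue_integral_def)
    also have "\<dots> = 1 / ?N"
      using emeasure_cell[OF n, of s] by (simp add: measure_def)
    finally show ?thesis by simp
  qed
  \<comment> \<open>\<open>a s\<close> is the mean of \<open>f\<close> over the cell, so
    \<open>g\<close> integrates to zero over each cell; this is what kills the cross term.\<close>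
  have orth: "integral\<^sup>L ?\<mu> (\<lambda>x. indicator (cell n s) x * g x) = 0" if s: "s \<in> grid n" for s
  proof -
    have "integral\<^sup>L ?\<mu> (\<lambda>x. indicator (cell n s) x * g x)
        = integral\<^sup>L ?\<mu> (\<lambda>x. a s * indicator (cell n s) x - indicator (cell n s) x * f x)"
      using iota_apply[OF n s, of _ a]
      by (intro Bochner_Integration.integral_cong) (auto simp: g_def indicator_def)
    also have "\<dots> = a s * (1 / ?N) - set_lebesgue_integral lebesgue (cell n s) f"
      using ind_mult[OF f_int, of s] ind_mult[of "\<lambda>_. 1" s] s
      by (subst Bochner_Integration.integral_diff)
         (simp_all only: integral_mult_right_zero int_one[OF s] int_cell[OF s], simp_all)
    also have "\<dots> = 0"
      using s n by (simp add: a_def delta_def)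
    finally show ?thesis .
  qed
  have split: "iota n h x - f x = iota n z x + g x" for x
    by (simp add: g_def z_def iota_def sum_subtractf[symmetric] sum.distrib[symmetric] algebra_simps)
  \<comment> \<open>Cells are disjoint, so squaring a step function squares its values.\<close>
  have iota_sq: "(iota n z x)\<^sup>2 = (\<Sum>s\<in>grid n. (z s)\<^sup>2 * indicator (cell n s) x)" for x
  proof (cases "\<exists>s\<in>grid n. x \<in> cell n s")
    case True
    then obtain s where s: "s \<in> grid n" "x \<in> cell n s" by blast
    then show ?thesis
      using iota_apply[OF n s, of z] iota_apply[OF n s, of "\<lambda>s. (z s)\<^sup>2"] by (simp add: iota_def)
  qed (simp add: iota_def)
  have ziota: "integral\<^sup>L ?\<mu> (\<lambda>x. (iota n z x)\<^sup>2) = (\<Sum>s\<in>grid n. (z s)\<^sup>2) / ?N"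
  proof -
    have "integral\<^sup>L ?\<mu> (\<lambda>x. (iota n z x)\<^sup>2) = (\<Sum>s\<in>grid n. integral\<^sup>L ?\<mu> (\<lambda>x. (z s)\<^sup>2 * indicator (cell n s) x))"
      unfolding iota_sq using ind_mult[of "\<lambda>_. 1"]
      by (subst Bochner_Integration.integral_sum) simp_all
    also have "\<dots> = (\<Sum>s\<in>grid n. (z s)\<^sup>2 * (1 / ?N))"
      by (intro sum.cong refl) (simp only: integral_mult_right_zero int_one)
    finally show ?thesis
      by (simp add: sum_divide_distrib)
  qed
  have cross_eq: "iota n z x * g x = (\<Sum>s\<in>grid n. z s * (indicator (cell n s) x * g x))" for x
    by (simp add: iota_def sum_distrib_right mult.assoc)
  have cross: "integral\<^sup>L ?\<mu> (\<lambda>x. iota n z x * g x) = 0"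
    unfolding cross_eq using ind_mult[OF g_int]
    by (subst Bochner_Integration.integral_sum) (auto simp: orth)
  have cross_int: "integrable ?\<mu> (\<lambda>x. iota n z x * g x)"
    unfolding cross_eq using ind_mult[OF g_int]
    by (intro Bochner_Integration.integrable_sum integrable_mult_right) auto
  have "(L2_norm (\<lambda>x. iota n h x - f x))\<^sup>2 = integral\<^sup>L ?\<mu> (\<lambda>x. (iota n z x + g x)\<^sup>2)"
    by (simp add: L2_norm_def split)
  also have "\<dots> = integral\<^sup>L ?\<mu> (\<lambda>x. (iota n z x)\<^sup>2 + (g x)\<^sup>2 + 2 * (iota n z x * g x))"
    by (simp add: power2_sum mult.assoc)
  also have "\<dots> = (\<Sum>s\<in>grid n. (z s)\<^sup>2) / ?N + integral\<^sup>L ?\<mu> (\<lambda>x. (g x)\<^sup>2)"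
    using iota_sq_int g2_int cross_int by (simp add: ziota cross)
  also have "integral\<^sup>L ?\<mu> (\<lambda>x. (g x)\<^sup>2) = (L2_norm (\<lambda>x. iota n a x - f x))\<^sup>2"
    by (simp add: L2_norm_def g_def)
  finally show ?thesis
    by (simp add: z_def a_def card_grid)
qed

section \<open>Noise bound uniform over families of fragments\<close>

text \<open>Arrays live in an infinite-dimensional function space, and an infinite basis would have
  \<open>card\<close> 0, so a bound on \<open>dim\<close> is informative only once the basis is
  known to be finite. It is finite because every member vanishes off the grid and so lies in the
  span of finitely many point masses.\<close>

lemma local_space_basis:
  fixes G :: "(real ^ 'd::finite \<Rightarrow> real) set"
  obtains B where "finite B" "card B = dim (local_space G n P)" "local_space G n P \<subseteq> span B"
proof -
  let ?\<delta> = "\<lambda>s t :: nat ^ 'd. of_bool (t = s) :: real"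
  obtain B where B: "B \<subseteq> local_space G n P" "independent B" "local_space G n P \<subseteq> span B"
    "card B = dim (local_space G n P)"
    by (rule basis_exists)
  have "v \<in> span (?\<delta> ` grid n)" if "v \<in> local_space G n P" for v
  proof -
    have "v t = 0" if "t \<notin> grid n" for t
      using \<open>v \<in> local_space G n P\<close> that by (auto simp: local_space_def delta_def)
    moreover have "(\<Sum>s\<in>A. v s *\<^sub>R ?\<delta> s) t = (if t \<in> A then v t else 0)" if "finite A" for A t
      using that by (induction A rule: finite_induct) (auto simp: scaleR_fun_def)
    ultimately have "v = (\<Sum>s\<in>grid n. v s *\<^sub>R ?\<delta> s)"
      using finite_grid[where 'd = 'd, of n] by (intro ext) simp
    moreover have "\<dots> \<in> span (?\<delta> ` grid n)"
      by (intro span_sum span_scale span_base) auto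
    ultimately show ?thesis by simp
  qed
  then have "B \<subseteq> span (?\<delta> ` grid n)"
    using B(1) by blast
  then have "finite B"
    using independent_span_bound[OF finite_imageI[OF finite_grid] B(2)] by blast
  then show thesis
    using B that by blast
qed

text \<open>Joining bases of the local spaces makes the dimension grow at most linearly in the
  number of fragments, even when fragments overlap.\<close>

lemma partition_space_orthonormal:
  fixes G :: "(real ^ 'd::finite \<Rightarrow> real) set"
  assumes "finite A" and dim: "\<And>P. P \<in> A \<Longrightarrow> dim (local_space G n P) \<le> D"
  shows "\<exists>m (e :: nat \<Rightarrow> nat ^ 'd \<Rightarrow> real). m \<le> card A * D \<and>
    (\<forall>i<m. \<forall>j<m. (\<Sum>s\<in>grid n. e i s * e j s) = of_bool (i = j)) \<and>
    (\<forall>v\<in>partition_space G n A. \<exists>c. \<forall>s\<in>grid n. v s = (\<Sum>i<m. c i * e i s))"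
proof -
  have "\<forall>P. \<exists>B. finite B \<and> card B = dim (local_space G n P) \<and> local_space G n P \<subseteq> span B"
    using local_space_basis by metis
  then obtain B where B: "\<And>P. finite (B P)" "\<And>P. card (B P) = dim (local_space G n P)"
    "\<And>P. local_space G n P \<subseteq> span (B P)"
    by metis
  have "card (\<Union>P\<in>A. B P) \<le> (\<Sum>P\<in>A. card (B P))"
    using \<open>finite A\<close> by (rule card_UN_le)
  also have "\<dots> \<le> (\<Sum>P\<in>A. D)"
    using B(2) dim by (intro sum_mono) simp
  finally have card: "card (\<Union>P\<in>A. B P) \<le> card A * D"
    by simp
  have "local_space G n P \<subseteq> span (\<Union>P\<in>A. B P)" if "P \<in> A" for P
    using B(3)[of P] span_mono[of "B P" "\<Union>P\<in>A. B P"] that by blast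
  then have "partition_space G n A \<subseteq> span (\<Union>P\<in>A. B P)"
    unfolding partition_space_def by (intro span_minimal) auto
  moreover have "finite (\<Union>P\<in>A. B P)"
    using \<open>finite A\<close> B(1) by blast
  from orthonormal_system_exists[OF finite_grid[where 'd = 'd, of n] this]
  obtain m and e :: "nat \<Rightarrow> nat ^ 'd \<Rightarrow> real" where "m \<le> card (\<Union>P\<in>A. B P)"
    "\<forall>i<m. \<forall>j<m. (\<Sum>s\<in>grid n. e i s * e j s) = of_bool (i = j)"
    "\<forall>v\<in>span (\<Union>P\<in>A. B P). \<exists>c. \<forall>s\<in>grid n. v s = (\<Sum>i<m. c i * e i s)"
    by (elim exE conjE)
  ultimately show ?thesis
    using card by (intro exI[of _ m] exI[of _ e]) (simp add: subset_iff)
qed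

text \<open>The union bound runs over all subfamilies of \<^term>\<open>R\<close>, disjoint or not, so that it also covers the
  union of two partitions. A family of \<open>k\<close> fragments has failure probability at most
  $|R|^{-k}$ times the common factor, and these terms sum to $(1 + 1/|R|)^{|R|} \<le> e$.\<close>

lemma (in prob_space) uniform_noise_bound:
  fixes \<xi> :: "nat ^ 'd::finite \<Rightarrow> 'a \<Rightarrow> real" and R :: "(nat ^ 'd) set set"
  defines "\<alpha> \<equiv> \<lambda>\<epsilon>. ln (2 / (1 - exp (- \<epsilon>))) + (1 - \<epsilon>) / \<epsilon>"
  assumes \<xi>: "\<And>s. s \<in> grid n \<Longrightarrow> \<xi> s \<in> borel_measurable M"
    and noise: "\<And>\<mu> c. c \<ge> 0 \<Longrightarrow>
         prob {\<omega> \<in> space M. \<bar>\<Sum>s\<in>grid n. \<mu> s * \<xi> s \<omega>\<bar> \<ge> c}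
           \<le> 2 * exp (- (c\<^sup>2 / (\<beta> * (\<Sum>s\<in>grid n. (\<mu> s)\<^sup>2))))"
    and R: "finite R" "R \<noteq> {}" and dim: "\<And>P. P \<in> R \<Longrightarrow> dim (local_space G n P) \<le> D"
    and pos: "0 < \<beta>" "0 < \<epsilon>" "\<epsilon> < 1" "0 < \<rho>" "0 < c" "0 < k0"
    and level: "D > 0 \<Longrightarrow> real D * \<alpha> \<epsilon> + ln (card R) \<le> (1 - \<epsilon>) / (1 + \<epsilon>) * (\<rho> * c / \<beta>)"
  shows "\<exists>B\<in>events. prob B \<le> 2 * exp (1 - k0 * ln (card R)) \<and>
    (\<forall>\<omega>\<in>space M - B. \<forall>A\<subseteq>R. \<forall>v\<in>partition_space G n A.
       (\<Sum>s\<in>grid n. v s * \<xi> s \<omega>)\<^sup>2 \<le> (\<Sum>s\<in>grid n. (v s)\<^sup>2) * (\<rho> * (c * (real (card A) + k0))))"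
proof -
  define L where "L = ln (real (card R))"
  define q where "q = (1 - \<epsilon>) / (1 + \<epsilon>) * (\<rho> * c / \<beta>)"
  have cardR: "0 < card R"
    using R by (simp add: card_gt_0_iff)
  then have L: "0 \<le> L" "exp (- L) = 1 / card R"
    by (simp_all add: L_def exp_minus inverse_eq_divide)
  \<comment> \<open>Nonnegativity of \<open>\<alpha> \<epsilon>\<close> is needed because
    \<open>card A * D\<close> only bounds the number of coordinates from above.\<close>
  have "0 \<le> ln (2 / (1 - exp (- \<epsilon>)))"
    using pos exp_gt_zero[of "- \<epsilon>"] by (intro ln_ge_zero) (simp add: pos_le_divide_eq del: exp_gt_zero)
  then have \<alpha>: "0 \<le> \<alpha> \<epsilon>"
    using pos by (simp add: \<alpha>_def)
  define orth where "orth A m e \<longleftrightarrow> m \<le> card A * D \<and>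
    (\<forall>i<m. \<forall>j<m. (\<Sum>s\<in>grid n. e i s * e j s) = of_bool (i = j)) \<and>
    (\<forall>v\<in>partition_space G n A. \<exists>c. \<forall>s\<in>grid n. v s = (\<Sum>i<m. c i * e i s))"
    for A m and e :: "nat \<Rightarrow> nat ^ 'd \<Rightarrow> real"
  have "\<exists>m e. orth A m e" if "A \<subseteq> R" for A
    unfolding orth_def using R dim that
    by (intro partition_space_orthonormal) (auto dest: finite_subset)
  then obtain m e where orth: "\<And>A. A \<subseteq> R \<Longrightarrow> orth A (m A) (e A)"
    by metis
  have m: "m A \<le> card A * D"
    and on: "\<And>i j. i < m A \<Longrightarrow> j < m A \<Longrightarrow> (\<Sum>s\<in>grid n. e A i s * e A j s) = of_bool (i = j)"
    and rep: "\<And>v. v \<in> partition_space G n A \<Longrightarrow> \<exists>c. \<forall>s\<in>grid n. v s = (\<Sum>i<m A. c i * e A i s)"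
    if "A \<subseteq> R" for A
    using orth[OF that] unfolding orth_def by simp_all
  \<comment> \<open>These are the coordinates of the noise in the system for \<open>A\<close>; the
    sum of their squares is the squared norm of the projected noise.\<close>
  define X where "X A i \<omega> = (\<Sum>s\<in>grid n. e A i s * \<xi> s \<omega>)" for A i \<omega>
  define T where "T A = \<rho> * (c * (real (card A) + k0))" for A :: "(nat ^ 'd) set set"
  define E where "E A = {\<omega> \<in> space M. T A \<le> (\<Sum>i<m A. (X A i \<omega>)\<^sup>2)}" for A
  have X [measurable]: "X A i \<in> borel_measurable M" for A i
    unfolding X_def using \<xi> by measurable
  have E [measurable]: "E A \<in> events" for A
    unfolding E_def by measurable
  have T: "0 < T A" for A
    using pos by (auto simp: T_def intro!: mult_pos_pos add_nonneg_pos)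
  have comb: "(\<Sum>i<k. a i * X A i \<omega>) = (\<Sum>s\<in>grid n. (\<Sum>i<k. a i * e A i s) * \<xi> s \<omega>)" for a A \<omega> k
    unfolding X_def sum_distrib_left sum_distrib_right
    by (subst sum.swap) (simp add: mult.assoc)
  have probE: "prob (E A) \<le> 2 * exp (- (k0 * L)) * exp (- L) ^ card A" if A: "A \<subseteq> R" for A
  proof (cases "m A = 0")
    \<comment> \<open>Without coordinates the failure event is empty, as \<open>T A\<close> is
      positive. This covers \<open>D = 0\<close>, where \<open>level\<close> gives nothing.\<close>
    case True
    then have "E A = {}"
      using T[of A] by (auto simp: E_def)
    then show ?thesis by simp
  next
    case False
    then have "D > 0"
      using m[OF A] by (cases D) auto
    from level[OF this] have level': "real D * \<alpha> \<epsilon> + L \<le> q"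
      by (simp add: L_def q_def)
    have "prob (E A) \<le> 2 * exp (real (m A) * \<alpha> \<epsilon> - (1 - \<epsilon>) / (1 + \<epsilon>) * (T A / \<beta>))"
      unfolding E_def \<alpha>_def
    proof (rule subgaussian_norm_tail)
      fix \<mu> :: "nat \<Rightarrow> real" and c :: real assume "0 \<le> c"
      from noise[OF this, of "\<lambda>s. \<Sum>i<m A. \<mu> i * e A i s"]
      show "prob {\<omega> \<in> space M. c \<le> \<bar>\<Sum>i<m A. \<mu> i * X A i \<omega>\<bar>} \<le> 2 * exp (- (c\<^sup>2 / (\<beta> * (\<Sum>i<m A. (\<mu> i)\<^sup>2))))"
        by (simp add: comb orthonormal_sum_mult on[OF A])
    qed (use pos in auto)
    \<comment> \<open>The share \<open>card A\<close> of the threshold pays for the dimension and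
      leaves \<open>exp (- L)\<close> per fragment; the share \<open>k0\<close> leaves the common
      factor \<open>exp (- (k0 * L))\<close>.\<close>
    also have "\<dots> \<le> 2 * exp (- (k0 * L) + real (card A) * (- L))"
    proof -
      have "real (m A) \<le> real (card A) * real D"
        using m[OF A] by (metis of_nat_le_iff of_nat_mult)
      then have "real (m A) * \<alpha> \<epsilon> \<le> real (card A) * real D * \<alpha> \<epsilon>"
        using \<alpha> by (rule mult_right_mono)
      moreover have "(1 - \<epsilon>) / (1 + \<epsilon>) * (T A / \<beta>) = q * real (card A) + q * k0"
        by (simp add: T_def q_def algebra_simps add_divide_distrib)
      moreover have "(real D * \<alpha> \<epsilon> + L) * real (card A) \<le> q * real (card A)"
        using level' by (intro mult_right_mono) auto
      moreover have "L \<le> q"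
        using level' \<alpha> by (smt (verit) mult_nonneg_nonneg of_nat_0_le_iff)
      then have "L * k0 \<le> q * k0"
        using pos by (intro mult_right_mono) auto
      ultimately show ?thesis
        by (simp add: algebra_simps)
    qed
    also have "\<dots> = 2 * exp (- (k0 * L)) * exp (- L) ^ card A"
      by (simp only: exp_add exp_of_nat_mult mult.assoc)
    finally show ?thesis .
  qed
  define B where "B = (\<Union>A\<in>Pow R. E A)"
  have B: "B \<in> events"
    unfolding B_def using R by (intro sets.finite_UN) auto
  have "prob B \<le> (\<Sum>A\<in>Pow R. prob (E A))"
    unfolding B_def using R by (intro finite_measure_subadditive_finite) auto
  also have "\<dots> \<le> (\<Sum>A\<in>Pow R. 2 * exp (- (k0 * L)) * exp (- L) ^ card A)"
    by (intro sum_mono probE) auto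
  also have "\<dots> = 2 * exp (- (k0 * L)) * (\<Sum>A\<in>Pow R. exp (- L) ^ card A)"
    by (simp add: sum_distrib_left)
  also have "(\<Sum>A\<in>Pow R. exp (- L) ^ card A) = (exp (- L) + 1) ^ card R"
    using prod_add[OF R(1), of "\<lambda>_. exp (- L)" "\<lambda>_. 1"] by simp
  also have "\<dots> \<le> exp (exp (- L)) ^ card R"
    using exp_ge_add_one_self[of "exp (- L)"] by (intro power_mono) (auto simp: add.commute)
  also have "\<dots> = exp 1"
    using cardR by (simp add: L flip: exp_of_nat_mult)
  finally have prob_B: "prob B \<le> 2 * exp (1 - k0 * L)"
    by (simp add: exp_diff exp_minus field_simps)
  have "(\<Sum>s\<in>grid n. v s * \<xi> s \<omega>)\<^sup>2 \<le> (\<Sum>s\<in>grid n. (v s)\<^sup>2) * T A"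
    if \<omega>: "\<omega> \<in> space M - B" and A: "A \<subseteq> R" and v: "v \<in> partition_space G n A" for \<omega> A v
  proof -
    obtain a where a: "\<And>s. s \<in> grid n \<Longrightarrow> v s = (\<Sum>i<m A. a i * e A i s)"
      using rep[OF A v] by blast
    have "(\<Sum>s\<in>grid n. v s * \<xi> s \<omega>)\<^sup>2 = (\<Sum>i<m A. a i * X A i \<omega>)\<^sup>2"
      by (simp add: comb a)
    also have "\<dots> \<le> (\<Sum>i<m A. (a i)\<^sup>2) * (\<Sum>i<m A. (X A i \<omega>)\<^sup>2)"
      by (rule Cauchy_Schwarz_ineq_sum)
    also have "(\<Sum>i<m A. (a i)\<^sup>2) = (\<Sum>s\<in>grid n. (v s)\<^sup>2)"
      using orthonormal_sum_mult[where m = "m A" and S = "grid n" and e = "e A" and c = a] on[OF A] by (simp add: a)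
    also have "\<dots> * (\<Sum>i<m A. (X A i \<omega>)\<^sup>2) \<le> \<dots> * T A"
      using \<omega> A by (intro mult_left_mono sum_nonneg) (auto simp: B_def E_def not_le less_imp_le)
    finally show ?thesis .
  qed
  then show ?thesis
    using B prob_B unfolding L_def T_def by blast
qed

section \<open>Almost sure convergence of the estimator\<close>

theorem theorem4:
  fixes \<MM> :: "nat set"
    and \<Omega> :: "'w measure"
    and \<xi> :: "nat \<Rightarrow> nat ^ ('d::finite) \<Rightarrow> 'w \<Rightarrow> real"
    and G :: "(real ^ 'd \<Rightarrow> real) set"
    and \<R> :: "nat \<Rightarrow> (nat ^ 'd) set set"
    and \<PP> :: "nat \<Rightarrow> (nat ^ 'd) set set set"
    and f :: "real ^ 'd \<Rightarrow> real"
    and Y :: "nat \<Rightarrow> 'w \<Rightarrow> nat ^ 'd \<Rightarrow> real"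
    and \<kappa> M \<beta> D :: real
    and \<gamma> :: "nat \<Rightarrow> real"
    and P_hat :: "nat \<Rightarrow> 'w \<Rightarrow> (nat ^ 'd) set set"
    and f_hat :: "nat \<Rightarrow> 'w \<Rightarrow> nat ^ 'd \<Rightarrow> real"
  assumes \<MM>: "infinite \<MM>" "\<MM> \<subseteq> {1..}"
    and \<Omega>: "prob_space \<Omega>"
    and \<xi>: "\<And>n s. n \<in> \<MM> \<Longrightarrow> s \<in> grid n \<Longrightarrow> \<xi> n s \<in> borel_measurable \<Omega>"
    and G: "fin_dim_L2_subspace G"
    and \<R>: "\<And>n. n \<in> \<MM> \<Longrightarrow> \<R> n \<subseteq> Pow (grid n)"
    and \<PP>_nonempty: "\<And>n. n \<in> \<MM> \<Longrightarrow> \<PP> n \<noteq> {}"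
    and \<PP>: "\<And>n Q. n \<in> \<MM> \<Longrightarrow> Q \<in> \<PP> n \<Longrightarrow> partition_on (grid n) Q \<and> Q \<subseteq> \<R> n"
    and f: "f \<in> L2_cube"
    and Y: "\<And>n \<omega> s. n \<in> \<MM> \<Longrightarrow> \<omega> \<in> space \<Omega> \<Longrightarrow> s \<in> grid n \<Longrightarrow>
              Y n \<omega> s = delta n f s + \<xi> n s \<omega>"
    and pos: "\<kappa> > 0" "M > 0" "\<beta> > 0"
    and fragments:
      "\<forall>\<^sub>F n in inf sequentially (principal \<MM>). real (card (\<R> n)) \<ge> M * real n powr \<kappa>"
    and noise:
      "\<And>n (\<mu> :: nat ^ 'd \<Rightarrow> real) c. n \<in> \<MM> \<Longrightarrow> c \<ge> 0 \<Longrightarrow>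
         measure \<Omega> {\<omega> \<in> space \<Omega>. \<bar>\<Sum>s\<in>grid n. \<mu> s * \<xi> n s \<omega>\<bar> \<ge> c}
           \<le> 2 * exp (- (c\<^sup>2 / (\<beta> * (\<Sum>s\<in>grid n. (\<mu> s)\<^sup>2))))"
    and D: "\<And>n P. n \<in> \<MM> \<Longrightarrow> P \<in> \<R> n \<Longrightarrow> real (dim (local_space G n P)) \<le> D"
    and \<gamma>_pos: "\<And>n. n \<in> \<MM> \<Longrightarrow> \<gamma> n > 0"
    and \<gamma>_lim: "(\<gamma> \<longlongrightarrow> 0) (inf sequentially (principal \<MM>))"
    and \<gamma>_lower:
      "\<forall>\<^sub>F n in inf sequentially (principal \<MM>).
         \<gamma> n > \<beta> * D * ((\<kappa> + 1) / \<kappa>) *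
               (ln (real (card (\<R> n))) / real (card (grid n :: (nat ^ 'd) set)))"
    and approx:
      "((\<lambda>k. Limsup (inf sequentially (principal \<MM>))
              (\<lambda>n. INF (Q, h) \<in> {(Q, h) \<in> segmentations G n (\<PP> n). card Q \<le> k}.
                     ereal ((L2_norm (\<lambda>x. iota n h x - f x))\<^sup>2)))
        \<longlongrightarrow> 0) sequentially"
    and minimiser:
      "\<And>n \<omega>. n \<in> \<MM> \<Longrightarrow> \<omega> \<in> space \<Omega> \<Longrightarrow>
         is_arg_min (penalized_fit n (\<gamma> n) (Y n \<omega>))
           (\<lambda>p. p \<in> segmentations G n (\<PP> n)) (P_hat n \<omega>, f_hat n \<omega>)"
  shows "AE \<omega> in \<Omega>.
           ((\<lambda>n. (L2_norm (\<lambda>x. iota n (f_hat n \<omega>) x - f x))\<^sup>2) \<longlongrightarrow> 0)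
             (inf sequentially (principal \<MM>))"
proof -
  interpret prob_space \<Omega> by (rule \<Omega>)
  let ?F = "inf sequentially (principal \<MM>)"
  let ?N = "\<lambda>n. real (card (grid n :: (nat ^ 'd) set))"
  let ?L = "\<lambda>n. ln (real (card (\<R> n)))"
  have ev_F: "eventually P ?F \<longleftrightarrow> (\<forall>\<^sub>F n in sequentially. n \<in> \<MM> \<longrightarrow> P n)" for P
    by (simp add: eventually_inf_principal)

  \<comment> \<open>The combined loss (1 - \<epsilon>)^2/(1 + \<epsilon>) is at least 1 -
    3\<epsilon>, and 3\<epsilon>(\<kappa> + 1) = 1/2, so exactly half of the surplus 1/\<kappa>
    survives in \<open>margin\<close>.\<close>
  define \<epsilon> where "\<epsilon> = 1 / (6 * (\<kappa> + 1))"
  define \<alpha> where "\<alpha> = ln (2 / (1 - exp (- \<epsilon>))) + (1 - \<epsilon>) / \<epsilon>"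
  \<comment> \<open>As \<open>card (\<R> n)\<close> is at least of order n^\<kappa>, its power with
    exponent -2/\<kappa> is at most of order n^(-2).\<close>
  define k0 where "k0 = 2 / \<kappa>"
  \<comment> \<open>Dimensions are integers, so the integer part of \<open>D\<close> still bounds
    them; \<open>m = 0\<close> covers the case in which all local spaces are trivial.\<close>
  define m where "m = nat \<lfloor>D\<rfloor>"
  have \<epsilon>: "0 < \<epsilon>" "\<epsilon> < 1"
    using pos by (auto simp: \<epsilon>_def field_simps)
  have k0: "0 < k0" "k0 * \<kappa> = 2"
    using pos by (auto simp: k0_def)
  have margin: "1 + 1 / (2 * \<kappa>) \<le> (1 - \<epsilon>) / (1 + \<epsilon>) * (1 - \<epsilon>) * ((\<kappa> + 1) / \<kappa>)"
  proof -
    have "(1 - 3 * \<epsilon>) * (1 + \<epsilon>) \<le> (1 - \<epsilon>) * (1 - \<epsilon>)"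
      using zero_le_power2[of \<epsilon>] by (simp add: algebra_simps power2_eq_square)
    then have "1 - 3 * \<epsilon> \<le> (1 - \<epsilon>) / (1 + \<epsilon>) * (1 - \<epsilon>)"
      using \<epsilon> by (simp add: pos_le_divide_eq)
    then have "(1 - 3 * \<epsilon>) * ((\<kappa> + 1) / \<kappa>) \<le> (1 - \<epsilon>) / (1 + \<epsilon>) * (1 - \<epsilon>) * ((\<kappa> + 1) / \<kappa>)"
      using pos by (intro mult_right_mono) auto
    moreover have "3 * \<epsilon> * (\<kappa> + 1) = 1 / 2"
      using pos by (simp add: \<epsilon>_def field_simps)
    then have "(1 - 3 * \<epsilon>) * ((\<kappa> + 1) / \<kappa>) = 1 + 1 / (2 * \<kappa>)"
      using pos by (simp add: field_simps)
    ultimately show ?thesis by linarith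
  qed

  \<comment> \<open>The lower bound 1 makes \<open>\<R> n\<close> finite and nonempty. The bound
    \<open>exp (2 * \<kappa> * \<alpha>)\<close> makes the cost \<alpha> per dimension at most
    \<open>?L n / (2 * \<kappa>)\<close>, the remaining half of the surplus.\<close>
  define good where "good n \<longleftrightarrow> n \<in> \<MM> \<and> 0 < n \<and> M * real n powr \<kappa> \<le> real (card (\<R> n)) \<and>
      max 1 (exp (2 * \<kappa> * \<alpha>)) \<le> M * real n powr \<kappa> \<and>
      \<beta> * D * ((\<kappa> + 1) / \<kappa>) * (?L n / ?N n) < \<gamma> n" for n
  have "LIM n sequentially. M * real n powr \<kappa> :> at_top"
    using pos by real_asymp
  then have "\<forall>\<^sub>F n in sequentially. max 1 (exp (2 * \<kappa> * \<alpha>)) \<le> M * real n powr \<kappa>"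
    by (simp only: filterlim_at_top)
  then have ev_good: "\<forall>\<^sub>F n in ?F. good n"
    using fragments \<gamma>_lower eventually_gt_at_top[of 0] unfolding ev_F
    by eventually_elim (simp add: good_def)

  define bound where "bound n B \<longleftrightarrow>
    (\<forall>\<omega>\<in>space \<Omega> - B. \<forall>A\<subseteq>\<R> n. \<forall>v\<in>partition_space G n A.
       (\<Sum>s\<in>grid n. v s * \<xi> n s \<omega>)\<^sup>2
         \<le> (\<Sum>s\<in>grid n. (v s)\<^sup>2) * ((1 - \<epsilon>) * (\<gamma> n * ?N n * (real (card A) + k0))))" for n B
  \<comment> \<open>For other indices the empty event is chosen, so the probability bound holds for
    every \<open>n\<close>, including \<open>n = 0\<close>, where its right-hand side is 0.\<close>
  have "\<exists>B\<in>events. prob B \<le> 2 * exp (1 - k0 * ln M) * inverse (real n ^ 2) \<and> (good n \<longrightarrow> bound n B)" for n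
  proof (cases "good n")
    case True
    then have n: "n \<in> \<MM>" "0 < n" and card_ge: "M * real n powr \<kappa> \<le> real (card (\<R> n))"
      and ge: "1 \<le> M * real n powr \<kappa>" "exp (2 * \<kappa> * \<alpha>) \<le> M * real n powr \<kappa>"
      and \<gamma>: "\<beta> * D * ((\<kappa> + 1) / \<kappa>) * (?L n / ?N n) < \<gamma> n"
      by (simp_all add: good_def)
    have card_R: "1 \<le> real (card (\<R> n))" "exp (2 * \<kappa> * \<alpha>) \<le> real (card (\<R> n))"
      using card_ge ge by linarith+
    then have R: "finite (\<R> n)" "\<R> n \<noteq> {}"
      by (auto intro: card_ge_0_finite)
    have L: "0 \<le> ?L n" "2 * \<kappa> * \<alpha> \<le> ?L n"
      using card_R by (simp_all add: ln_ge_iff)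
    have N: "0 < ?N n"
      using n by (simp add: card_grid)
    have dim: "dim (local_space G n P) \<le> m" if "P \<in> \<R> n" for P
      using D[OF n(1) that] unfolding m_def by linarith
    have level: "real m * \<alpha> + ?L n \<le> (1 - \<epsilon>) / (1 + \<epsilon>) * ((1 - \<epsilon>) * (\<gamma> n * ?N n) / \<beta>)" if "m > 0"
    proof -
      let ?\<theta> = "(1 - \<epsilon>) / (1 + \<epsilon>) * (1 - \<epsilon>)"
      have m: "real m \<le> D" "1 \<le> real m"
        using that unfolding m_def by linarith+
      have "real m * \<alpha> \<le> real m * (?L n / (2 * \<kappa>))"
        using L pos by (intro mult_left_mono) (auto simp: field_simps)
      moreover have "1 * ?L n \<le> real m * ?L n"
        using L m by (intro mult_right_mono) auto
      ultimately have "real m * \<alpha> + ?L n \<le> (1 + 1 / (2 * \<kappa>)) * (real m * ?L n)"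
        by (simp add: algebra_simps)
      also have "\<dots> \<le> ?\<theta> * ((\<kappa> + 1) / \<kappa>) * (D * ?L n)"
        using L m pos \<epsilon> margin by (intro mult_mono) (auto intro: order_trans[OF _ margin])
      also have "\<dots> = ?\<theta> * ((\<beta> * D * ((\<kappa> + 1) / \<kappa>) * (?L n / ?N n)) * ?N n / \<beta>)"
      proof -
        have "\<beta> * D * x * (l / N) * N / \<beta> = x * (D * l)" if "0 < N" for x l N
          using pos that by simp
        from this[OF N] show ?thesis
          by (simp only: mult.assoc)
      qed
      also have "\<dots> \<le> ?\<theta> * (\<gamma> n * ?N n / \<beta>)"
        using \<gamma> N \<epsilon> pos by (intro mult_left_mono divide_right_mono mult_right_mono) auto
      finally show ?thesis by (simp add: mult.assoc)
    qed
    have "0 < \<gamma> n * ?N n"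
      using \<gamma>_pos[OF n(1)] N by simp
    from uniform_noise_bound[where n = n and \<xi> = "\<xi> n" and R = "\<R> n" and D = m and c = "\<gamma> n * ?N n"
        and \<beta> = \<beta> and \<epsilon> = \<epsilon> and \<rho> = "1 - \<epsilon>" and ?k0.0 = k0 and G = G,
        OF \<xi>[OF n(1)] noise[OF n(1)] R dim, folded \<alpha>_def]
    obtain B where B: "B \<in> events" "prob B \<le> 2 * exp (1 - k0 * ?L n)" "bound n B"
      using pos \<epsilon> k0 level \<open>0 < \<gamma> n * ?N n\<close> unfolding bound_def by auto
    have "ln M + \<kappa> * ln (real n) = ln (M * real n powr \<kappa>)"
      using pos n by (simp add: ln_mult ln_powr)
    also have "\<dots> \<le> ?L n"
      using card_ge ge by simp
    finally have "k0 * (ln M + \<kappa> * ln (real n)) \<le> k0 * ?L n"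
      using k0 by (intro mult_left_mono) auto
    moreover have "k0 * (ln M + \<kappa> * ln (real n)) = k0 * ln M + 2 * ln (real n)"
      by (simp add: distrib_left k0(2) flip: mult.assoc)
    ultimately have "exp (1 - k0 * ?L n) \<le> exp (1 - k0 * ln M - 2 * ln (real n))"
      by simp
    also have "\<dots> = exp (1 - k0 * ln M) * inverse (real n ^ 2)"
      using n exp_of_nat_mult[of 2 "ln (real n)"] by (simp add: exp_diff divide_inverse)
    finally show ?thesis
      using B by (intro bexI[of _ B]) auto
  qed (auto intro!: bexI[of _ "{}"])
  then obtain B where B: "\<And>n. B n \<in> events"
    "\<And>n. prob (B n) \<le> 2 * exp (1 - k0 * ln M) * inverse (real n ^ 2)"
    "\<And>n. good n \<Longrightarrow> bound n (B n)"
    by metis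
  have "summable (\<lambda>n. 2 * exp (1 - k0 * ln M) * inverse (real n ^ 2))"
    by (intro summable_mult inverse_power_summable) auto
  then have "summable (\<lambda>n. prob (B n))"
    by (rule summable_comparison_test') (use B(2) in auto)
  then have "AE \<omega> in \<Omega>. \<forall>\<^sub>F n in sequentially. \<omega> \<in> space \<Omega> - B n"
    using B(1) by (intro borel_cantelli_AE1) (auto simp: emeasure_eq_measure)
  then show ?thesis
  proof (rule AE_mp, intro AE_I2 impI)
    \<comment> \<open>From here on \<omega> is fixed and the argument is deterministic; randomness
      enters only through the uniform noise bound.\<close>
    fix \<omega> assume \<omega>: "\<omega> \<in> space \<Omega>" and ev_B: "\<forall>\<^sub>F n in sequentially. \<omega> \<in> space \<Omega> - B n"
    have error_bound: "(L2_norm (\<lambda>x. iota n (f_hat n \<omega>) x - f x))\<^sup>2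
        \<le> (\<gamma> n * (2 * real k + k0) + (1 + 1 / \<epsilon>) * E) / \<epsilon>\<^sup>2 + E"
      if n: "good n" "\<omega> \<in> space \<Omega> - B n" and h: "(Q, h) \<in> segmentations G n (\<PP> n)" "card Q \<le> k"
        and E: "E = (L2_norm (\<lambda>x. iota n h x - f x))\<^sup>2" for n k Q h E
    proof -
      let ?P = "P_hat n \<omega>" and ?u = "f_hat n \<omega>" and ?a = "delta n f"
      have nM: "n \<in> \<MM>" "0 < n"
        using n by (auto simp: good_def)
      have N: "0 < ?N n"
        using nM by (simp add: card_grid)
      have opt: "(?P, ?u) \<in> segmentations G n (\<PP> n)"
        "penalized_fit n (\<gamma> n) (Y n \<omega>) (?P, ?u) \<le> penalized_fit n (\<gamma> n) (Y n \<omega>) (Q, h)"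
        using minimiser[OF nM(1) \<omega>] h by (auto simp: is_arg_min_def not_less)
      have sub: "?P \<subseteq> \<R> n" "?u \<in> partition_space G n ?P" "Q \<subseteq> \<R> n" "h \<in> partition_space G n Q"
        using opt(1) h(1) \<PP>[OF nM(1)] by (auto simp: segmentations_def)
      have mono: "partition_space G n A \<subseteq> partition_space G n (?P \<union> Q)" if "A \<subseteq> ?P \<union> Q" for A
        unfolding partition_space_def using that by (intro span_mono) blast
      have diff: "?u - h \<in> partition_space G n (?P \<union> Q)"
        using sub mono[of ?P] mono[of Q] unfolding partition_space_def by (intro span_diff) auto
      have "?P \<union> Q \<subseteq> \<R> n"
        using sub by blast
      note B(3)[OF n(1), unfolded bound_def, rule_format, OF n(2) this diff]
      then have "(\<Sum>s\<in>grid n. (?u s - h s) * \<xi> n s \<omega>)\<^sup>2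
          \<le> (\<Sum>s\<in>grid n. (?u s - h s)\<^sup>2) * ((1 - \<epsilon>) * (\<gamma> n * ?N n * (real (card (?P \<union> Q)) + k0)))"
        by simp
      also have "\<dots> \<le> (\<Sum>s\<in>grid n. (?u s - h s)\<^sup>2) *
          ((1 - \<epsilon>) * (\<gamma> n * ?N n * (real (card ?P) + real (card Q) + k0)))"
        using \<epsilon> \<gamma>_pos[OF nM(1)] of_nat_mono[OF card_Un_le[of ?P Q], where 'a = real]
        by (intro mult_left_mono sum_nonneg) auto
      finally have noise_bound: "(\<Sum>s\<in>grid n. (?u s - h s) * \<xi> n s \<omega>)\<^sup>2 \<le> \<dots>" .
      \<comment> \<open>Clearing the denominator makes \<open>\<gamma> n * ?N n\<close> the penalty
        constant of the least squares inequality.\<close>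
      have fit: "penalized_fit n (\<gamma> n) (Y n \<omega>) (A, v) * ?N n =
          \<gamma> n * ?N n * real (card A) + (\<Sum>s\<in>grid n. (v s - (?a s + \<xi> n s \<omega>))\<^sup>2)" for A v
        using N Y[OF nM(1) \<omega>]
        by (simp add: penalized_fit_def L2_set_def sum_nonneg distrib_right)
      have "\<epsilon>\<^sup>2 * (\<Sum>s\<in>grid n. (?u s - ?a s)\<^sup>2) \<le> \<gamma> n * ?N n * (2 * real (card Q) + k0) +
          (1 + 1 / \<epsilon>) * (\<Sum>s\<in>grid n. (h s - ?a s)\<^sup>2)"
      proof (rule penalized_least_squares_bound)
        show "\<gamma> n * ?N n * real (card ?P) + (\<Sum>s\<in>grid n. (?u s - (?a s + \<xi> n s \<omega>))\<^sup>2)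
            \<le> \<gamma> n * ?N n * real (card Q) + (\<Sum>s\<in>grid n. (h s - (?a s + \<xi> n s \<omega>))\<^sup>2)"
          using mult_right_mono[OF opt(2), of "?N n"] by (simp only: fit)
      qed (use \<epsilon> k0 \<gamma>_pos[OF nM(1)] noise_bound in auto)
      also have "\<dots> \<le> \<gamma> n * ?N n * (2 * real k + k0) + (1 + 1 / \<epsilon>) * (\<Sum>s\<in>grid n. (h s - ?a s)\<^sup>2)"
        using h(2) \<gamma>_pos[OF nM(1)] by (intro add_right_mono mult_left_mono) auto
      finally have "(\<Sum>s\<in>grid n. (?u s - ?a s)\<^sup>2) / ?N n
          \<le> (\<gamma> n * (2 * real k + k0) + (1 + 1 / \<epsilon>) * ((\<Sum>s\<in>grid n. (h s - ?a s)\<^sup>2) / ?N n)) / \<epsilon>\<^sup>2"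
        using N \<epsilon> by (simp add: field_simps)
      \<comment> \<open>By Pythagoras the competitor's error dominates both its distance to
        \<open>delta n f\<close> and the discretisation error of \<open>f\<close>, so the latter
        needs no separate limit argument.\<close>
      moreover have "(\<Sum>s\<in>grid n. (h s - ?a s)\<^sup>2) / ?N n \<le> E"
        "(L2_norm (\<lambda>x. iota n ?a x - f x))\<^sup>2 \<le> E"
        unfolding E L2_norm_iota_diff[OF f nM(2), of h] by (simp_all add: sum_nonneg)
      moreover from this(1) have "(\<gamma> n * (2 * real k + k0) + (1 + 1 / \<epsilon>) * ((\<Sum>s\<in>grid n. (h s - ?a s)\<^sup>2) / ?N n)) / \<epsilon>\<^sup>2
          \<le> (\<gamma> n * (2 * real k + k0) + (1 + 1 / \<epsilon>) * E) / \<epsilon>\<^sup>2"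
        using \<epsilon> by (intro divide_right_mono add_left_mono mult_left_mono) auto
      ultimately show ?thesis
        unfolding L2_norm_iota_diff[OF f nM(2), of ?u] by linarith
    qed
    show "((\<lambda>n. (L2_norm (\<lambda>x. iota n (f_hat n \<omega>) x - f x))\<^sup>2) \<longlongrightarrow> 0) ?F"
    proof (rule tendstoI)
      fix \<delta> :: real assume "0 < \<delta>"
      \<comment> \<open>\<open>C\<close> collects the coefficients of \<open>E\<close> in
        \<open>error_bound\<close>; \<eta> reserves half of \<delta> for the approximation error and
        leaves half for the penalty.\<close>
      define C where "C = (1 + 1 / \<epsilon>) / \<epsilon>\<^sup>2 + 1"
      define \<eta> where "\<eta> = \<delta> / (2 * C)"
      have C: "0 < C"
        using \<epsilon> by (simp add: C_def add_pos_pos)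
      then have \<eta>: "0 < \<eta>" "C * \<eta> = \<delta> / 2"
        using \<open>0 < \<delta>\<close> by (simp_all add: \<eta>_def)
      \<comment> \<open>The complexity \<open>k\<close> is fixed before \<open>n\<close> grows. The
        competitor may vary with \<open>n\<close>, but its penalty stays at most
        \<open>\<gamma> n * k\<close> and hence vanishes.\<close>
      obtain k where "Limsup ?F (\<lambda>n. INF (Q, h) \<in> {(Q, h) \<in> segmentations G n (\<PP> n). card Q \<le> k}.
          ereal ((L2_norm (\<lambda>x. iota n h x - f x))\<^sup>2)) < ereal \<eta>"
        using order_tendstoD(2)[OF approx, of "ereal \<eta>"] \<eta> eventually_happens[of _ sequentially] by force
      from Limsup_lessD[OF this]
      have ev_h: "\<forall>\<^sub>F n in ?F. \<exists>Q h. (Q, h) \<in> segmentations G n (\<PP> n) \<and> card Q \<le> k \<and>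
          (L2_norm (\<lambda>x. iota n h x - f x))\<^sup>2 < \<eta>"
        by eventually_elim (auto simp: INF_less_iff)
      have "((\<lambda>n. \<gamma> n * (2 * real k + k0) / \<epsilon>\<^sup>2) \<longlongrightarrow> 0 * (2 * real k + k0) / \<epsilon>\<^sup>2) ?F"
        using \<epsilon> by (intro tendsto_intros \<gamma>_lim) auto
      then have ev_\<gamma>: "\<forall>\<^sub>F n in ?F. \<gamma> n * (2 * real k + k0) / \<epsilon>\<^sup>2 < \<delta> / 2"
        by (rule order_tendstoD(2)) (use \<open>0 < \<delta>\<close> in simp)
      have "\<forall>\<^sub>F n in ?F. \<omega> \<in> space \<Omega> - B n"
        using ev_B unfolding ev_F by eventually_elim simp
      from this ev_good ev_h ev_\<gamma>
      show "\<forall>\<^sub>F n in ?F. dist ((L2_norm (\<lambda>x. iota n (f_hat n \<omega>) x - f x))\<^sup>2) 0 < \<delta>"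
      proof eventually_elim
        case (elim n)
        then obtain Q h where h: "(Q, h) \<in> segmentations G n (\<PP> n)" "card Q \<le> k"
          "(L2_norm (\<lambda>x. iota n h x - f x))\<^sup>2 < \<eta>"
          by blast
        define E where "E = (L2_norm (\<lambda>x. iota n h x - f x))\<^sup>2"
        have "(L2_norm (\<lambda>x. iota n (f_hat n \<omega>) x - f x))\<^sup>2
            \<le> (\<gamma> n * (2 * real k + k0) + (1 + 1 / \<epsilon>) * E) / \<epsilon>\<^sup>2 + E"
          using error_bound[OF elim(2,1) h(1,2) E_def] .
        also have "\<dots> = \<gamma> n * (2 * real k + k0) / \<epsilon>\<^sup>2 + C * E"
          by (simp add: C_def add_divide_distrib distrib_right)
        also have "C * E < C * \<eta>"
          using h(3) C by (simp add: E_def)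
        finally have "(L2_norm (\<lambda>x. iota n (f_hat n \<omega>) x - f x))\<^sup>2 < \<delta>"
          using elim(4) \<eta>(2) by linarith
        then show ?case by simp
      qed
    qed
  qed
qed

end
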